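(* Let $(\mathcal U\to\mathcal X\to(B,b_0))$ be a splitting type deformation and suppose the fiber over $b_0$ represents the embedding of split models. Then the total space $(\mathcal U\to\mathcal X)$ is split (as a supermanifold).
   Context: A model $(Y,T^*_{Y,-})$ is a complex manifold $Y$ with a holomorphic vector bundle $T^*_{Y,-}$. For $j\ge2$, $\mathcal G^{(j)}_{T^*_{Y,-}}$ is the sheaf of groups of parity-preserving $\mathbb C$-algebra automorphisms $\alpha$ of $\wedge^\bullet T^*_{Y,-}$ with $\alpha(u)-u\in\bigoplus_{k\ge j}\wedge^kT^*_{Y,-}$ for all local sections $u$. A supermanifold $(\mathcal U\to\mathcal X)$ modelled on $(Y,T^*_{Y,-})$ with splitting type $j$ is a representative of a class in the pointed set $\check H^1(Y,\mathcal G^{(j)}_{T^*_{Y,-}})$, which glues to a locally ringed space $\mathcal X$ with structure sheaf locally isomorphic to $\wedge^\bullet T^*_{Y,-}$; for $j>\mathrm{rank}\,T^*_{Y,-}$ the sheaf is trivial, one writes $j=\infty$, and the supermanifold is the split model $S(Y,T^*_{Y,-})=(Y,\wedge^\bullet T^*_{Y,-})$. A supermanifold is split if it is isomorphic, as a supermanifold, to the split model. Standing assumption: a supermanifold of splitting type $j$ does not have splitting type $j+1$ unless $j=\infty$. An embedding of models $(X,T^*_{X,-})\subset(Y,T^*_{Y,-})$ is an inclusion $i:X\subset Y$ of a submanifold with a surjection $i^*T^*_{Y,-}\to T^*_{X,-}$. Let $\mathcal G^{(j)}_{T^*_{X,-};T^*_{Y,-}}\subset\mathcal G^{(j)}_{T^*_{Y,-}}$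 be the automorphisms restricting to automorphisms in $\mathcal G^{(j)}_{T^*_{X,-}}$, with induced maps of pointed sets $u_*$ to $\check H^1(Y,\mathcal G^{(j)}_{T^*_{Y,-}})$ and $r_*$ to $\check H^1(X,\mathcal G^{(j)}_{T^*_{X,-}})$; the base-point of $\check H^1(Y,\mathcal G^{(j)}_{T^*_{X,-};T^*_{Y,-}})$ is represented by the embedding of split models $S(X,T^*_{X,-})\subset S(Y,T^*_{Y,-})$. An embedding of splitting type $(j'',j,j')$, $j''\le j,j'$, of a supermanifold of splitting type $j$ modelled on $(X,T^*_{X,-})$ in one of splitting type $j'$ modelled on $(Y,T^*_{Y,-})$ is a class $c\in\check H^1(Y,\mathcal G^{(j'')}_{T^*_{X,-};T^*_{Y,-}})$ such that $r_*(c)$ and $u_*(c)$ are the images of the classes of the two supermanifolds in level $j''$ (under the maps on $\check H^1$ induced by $\mathcal G^{(j)}\subset\mathcal G^{(j'')}$ and $\mathcal G^{(j')}\subset\mathcal G^{(j'')}$). A family of supermanifolds $(\mathcal U\to\mathcal X\to B)$ modelled on $(X,T^*_{X,-})$ is a supermanifold $(\mathcal U\to\mathcal X)$ of splitting type $j'$ (the total space, modelled on some $(Y,T^*_{Y,-})$) with a morphism $f:\mathcal X\to B$ whose reduced part $Y\to B$ is an analytic family of compact complex manifolds (surjective holomorphic submersion with compact fibers), and for each $b\in B$ a supermanifold $(\mathcal U_b\to\mathcal X_b)$ modelled on $(X,T^*_{X,-})$ of splitting type $j_b$ together with an embedding in $(\mathcal U\to\mathcal X)$ of some splitting type $(j''_b,j_b,j')$,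 with class $c_b\in\check H^1(Y,\mathcal G^{(j''_b)}_{T^*_{X,-};T^*_{Y,-}})$. A splitting type deformation $(\mathcal U\to\mathcal X\to(B,b_0))$ is such a family with a distinguished base-point $b_0$. The fiber over $b_0$ represents the embedding of split models if $c_{b_0}$ is the base-point. *)

theory Defs
  imports "HOL-Analysis.Analysis" "HOL-Algebra.Module" "HOL-Library.Extended_Nat"
begin

section \<open>Complex manifolds\<close>

text \<open>
  \<open>Cn n\<close> is the space of all \<open>z :: nat \<Rightarrow> complex\<close> supported on \<open>{..<n}\<close>. With the topology
  induced from the product topology it is the Euclidean space of complex dimension \<open>n\<close>, and
  \<open>Cn m \<subseteq> Cn n\<close> is the standard linear subspace for \<open>m \<le> n\<close>. Dimension 0 is allowed.
\<close>

definition Cn :: "nat \<Rightarrow> (nat \<Rightarrow> complex) set" where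
  "Cn n = {z. \<forall>i\<ge>n. z i = 0}"

text \<open>Holomorphic functions of several variables on an open \<open>W \<subseteq> Cn n\<close>: continuous, and
  holomorphic in each variable separately.\<close>

definition holo_on_Cn :: "nat \<Rightarrow> (nat \<Rightarrow> complex) set \<Rightarrow> ((nat \<Rightarrow> complex) \<Rightarrow> complex) \<Rightarrow> bool" where
  "holo_on_Cn n W F \<longleftrightarrow>
     continuous_on W F \<and>
     (\<forall>z\<in>W. \<forall>k<n. (\<lambda>t. F (z(k := t))) field_differentiable at (z k))"

type_synonym 'a chart = "'a set \<times> ('a \<Rightarrow> nat \<Rightarrow> complex)"

definition chart_on :: "'a topology \<Rightarrow> nat \<Rightarrow> 'a chart \<Rightarrow> bool" where
  "chart_on T n = (\<lambda>(U, \<phi>). openin T U \<and> openin (top_of_set (Cn n)) (\<phi> ` U) \<and>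
     homeomorphic_map (subtopology T U) (top_of_set (\<phi> ` U)) \<phi>)"

definition chart_compat :: "nat \<Rightarrow> 'a chart \<Rightarrow> 'a chart \<Rightarrow> bool" where
  "chart_compat n = (\<lambda>(U, \<phi>) (V, \<psi>). \<forall>i<n.
     holo_on_Cn n (\<phi> ` (U \<inter> V)) (\<lambda>z. \<psi> (inv_into U \<phi> z) i) \<and>
     holo_on_Cn n (\<psi> ` (U \<inter> V)) (\<lambda>z. \<phi> (inv_into V \<psi> z) i))"

record 'a cmfd =
  mtop :: "'a topology"
  mdim :: nat
  atlas :: "'a chart set"

definition complex_manifold :: "'a cmfd \<Rightarrow> bool" where
  "complex_manifold M \<longleftrightarrow>
     Hausdorff_space (mtop M) \<and> second_countable (mtop M) \<and>
     (\<forall>c\<in>atlas M. chart_on (mtop M) (mdim M) c) \<and>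
     (\<forall>c\<in>atlas M. \<forall>d\<in>atlas M. chart_compat (mdim M) c d) \<and>
     \<Union> (fst ` atlas M) = topspace (mtop M)"

definition max_atlas :: "'a cmfd \<Rightarrow> 'a chart set" where
  "max_atlas M = {c. chart_on (mtop M) (mdim M) c \<and> (\<forall>d\<in>atlas M. chart_compat (mdim M) c d)}"

definition preim :: "'a topology \<Rightarrow> ('a \<Rightarrow> 'b) \<Rightarrow> 'b set \<Rightarrow> 'a set" where
  "preim T f V = {x \<in> topspace T. f x \<in> V}"

definition holo_fun :: "'a cmfd \<Rightarrow> 'a set \<Rightarrow> ('a \<Rightarrow> complex) \<Rightarrow> bool" where
  "holo_fun M W f \<longleftrightarrow>
     (\<forall>(U, \<phi>)\<in>atlas M. holo_on_Cn (mdim M) (\<phi> ` (U \<inter> W)) (\<lambda>z. f (inv_into U \<phi> z)))"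

definition holo_map :: "'a cmfd \<Rightarrow> 'b cmfd \<Rightarrow> ('a \<Rightarrow> 'b) \<Rightarrow> bool" where
  "holo_map M N f \<longleftrightarrow>
     continuous_map (mtop M) (mtop N) f \<and>
     (\<forall>(U, \<phi>)\<in>atlas M. \<forall>(V, \<psi>)\<in>atlas N. \<forall>i<mdim N.
        holo_on_Cn (mdim M) (\<phi> ` (U \<inter> preim (mtop M) f V)) (\<lambda>z. \<psi> (f (inv_into U \<phi> z)) i))"

definition partial_deriv :: "((nat \<Rightarrow> complex) \<Rightarrow> complex) \<Rightarrow> nat \<Rightarrow> (nat \<Rightarrow> complex) \<Rightarrow> complex" where
  "partial_deriv F k z = deriv (\<lambda>t. F (z(k := t))) (z k)"

definition submersion :: "'a cmfd \<Rightarrow> 'b cmfd \<Rightarrow> ('a \<Rightarrow> 'b) \<Rightarrow> bool" where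
  "submersion M N f \<longleftrightarrow>
     (\<forall>y\<in>topspace (mtop M). \<forall>(U, \<phi>)\<in>atlas M. \<forall>(V, \<psi>)\<in>atlas N. y \<in> U \<longrightarrow> f y \<in> V \<longrightarrow>
        (\<forall>w\<in>Cn (mdim N). \<exists>v\<in>Cn (mdim M). \<forall>i<mdim N.
           w i = (\<Sum>k<mdim M. partial_deriv (\<lambda>z. \<psi> (f (inv_into U \<phi> z)) i) k (\<phi> y) * v k)))"

definition analytic_family :: "'a cmfd \<Rightarrow> 'b cmfd \<Rightarrow> ('a \<Rightarrow> 'b) \<Rightarrow> bool" where
  "analytic_family Y B f \<longleftrightarrow>
     holo_map Y B f \<and> f ` topspace (mtop Y) = topspace (mtop B) \<and> submersion Y B f \<and>
     (\<forall>b\<in>topspace (mtop B). compactin (mtop Y) (preim (mtop Y) f {b}))"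

text \<open>Inclusion of a submanifold: around every point of \<open>X\<close> there is a chart of \<open>Y\<close> in which
  the image of \<open>X\<close> is a coordinate plane, and which restricts to a chart of \<open>X\<close>.\<close>

definition submanifold_inclusion :: "'x cmfd \<Rightarrow> 'y cmfd \<Rightarrow> ('x \<Rightarrow> 'y) \<Rightarrow> bool" where
  "submanifold_inclusion X Y i \<longleftrightarrow>
     inj_on i (topspace (mtop X)) \<and> i ` topspace (mtop X) \<subseteq> topspace (mtop Y) \<and>
     (\<forall>x\<in>topspace (mtop X). \<exists>(V, \<psi>)\<in>max_atlas Y.
        i x \<in> V \<and>
        \<psi> ` (V \<inter> i ` topspace (mtop X)) = \<psi> ` V \<inter> Cn (mdim X) \<and>
        (preim (mtop X) i V, \<psi> \<circ> i) \<in> max_atlas X)"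


section \<open>Holomorphic vector bundles and their exterior algebras\<close>

text \<open>
  A trivialisation \<open>(U, t)\<close> maps each fibre over \<open>U\<close> bijectively to \<open>Cn (vb_rank E)\<close>. The
  topology, complex structure and fibrewise linear structure of the total space are those induced
  by the trivialisations.
\<close>

record ('a, 'e) vbundle =
  vb_total :: "'e set"
  vb_proj :: "'e \<Rightarrow> 'a"
  vb_rank :: nat
  vb_triv :: "('a set \<times> ('e \<Rightarrow> nat \<Rightarrow> complex)) set"

definition fibre :: "('a, 'e) vbundle \<Rightarrow> 'a \<Rightarrow> 'e set" where
  "fibre E y = {e \<in> vb_total E. vb_proj E e = y}"

definition holo_vbundle :: "'a cmfd \<Rightarrow> ('a, 'e) vbundle \<Rightarrow> bool" where
  "holo_vbundle M E \<longleftrightarrow>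
     vb_proj E ` vb_total E \<subseteq> topspace (mtop M) \<and>
     \<Union> (fst ` vb_triv E) = topspace (mtop M) \<and>
     (\<forall>(U, t)\<in>vb_triv E. openin (mtop M) U \<and>
        (\<forall>y\<in>U. bij_betw t (fibre E y) (Cn (vb_rank E)))) \<and>
     (\<forall>(U, t)\<in>vb_triv E. \<forall>(V, s)\<in>vb_triv E. \<exists>A :: 'a \<Rightarrow> nat \<Rightarrow> nat \<Rightarrow> complex.
        (\<forall>i<vb_rank E. \<forall>k<vb_rank E. holo_fun M (U \<inter> V) (\<lambda>y. A y i k)) \<and>
        (\<forall>y\<in>U \<inter> V. \<forall>e\<in>fibre E y. \<forall>i<vb_rank E. s e i = (\<Sum>k<vb_rank E. A y i k * t e k)))"

text \<open>Linear functionals on the fibre over \<open>y\<close>, extended by \<open>undefined\<close>.\<close>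

definition fdual :: "('a, 'e) vbundle \<Rightarrow> 'a \<Rightarrow> ('e \<Rightarrow> complex) set" where
  "fdual E y = {l \<in> extensional (fibre E y). \<forall>(U, t)\<in>vb_triv E. y \<in> U \<longrightarrow>
     (\<exists>a :: nat \<Rightarrow> complex. \<forall>e\<in>fibre E y. l e = (\<Sum>k<vb_rank E. a k * t e k))}"

definition coord :: "('a, 'e) vbundle \<Rightarrow> ('e \<Rightarrow> nat \<Rightarrow> complex) \<Rightarrow> 'a \<Rightarrow> nat \<Rightarrow> ('e \<Rightarrow> complex)" where
  "coord E t y i = restrict (\<lambda>e. t e i) (fibre E y)"

text \<open>
  The \<open>k\<close>-th exterior power of a finite-dimensional complex vector space \<open>V\<close> is realised as the
  space of alternating \<open>k\<close>-linear forms on the dual of \<open>V\<close>. An element of the exterior algebra is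
  one function on lists of functionals, whose part of degree \<open>k\<close> is its restriction to lists of
  length \<open>k\<close> (so the parts of degree above the dimension vanish); it is 0 on lists
  containing anything but functionals.
\<close>

type_synonym 'e form = "('e \<Rightarrow> complex) list \<Rightarrow> complex"

definition ext_alg :: "('a, 'e) vbundle \<Rightarrow> 'a \<Rightarrow> 'e form set" where
  "ext_alg E y = {\<omega>.
     (\<forall>ls. \<not> set ls \<subseteq> fdual E y \<longrightarrow> \<omega> ls = 0) \<and>
     (\<forall>ls k a b. \<forall>l\<in>fdual E y. \<forall>l'\<in>fdual E y. set ls \<subseteq> fdual E y \<longrightarrow> k < length ls \<longrightarrow>
        \<omega> (ls[k := restrict (\<lambda>e. a * l e + b * l' e) (fibre E y)]) =
          a * \<omega> (ls[k := l]) + b * \<omega> (ls[k := l'])) \<and>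
     (\<forall>ls i k. i < k \<longrightarrow> k < length ls \<longrightarrow> ls ! i = ls ! k \<longrightarrow> \<omega> ls = 0)}"

text \<open>The product is a sum over shuffles: \<open>I\<close> is the set of positions fed to the first factor,
  and the sign counts the inversions of the corresponding permutation. Hence the product of
  vectors \<open>u\<close>, \<open>v\<close> maps \<open>[l, l']\<close> to \<open>l u * l' v - l' u * l v\<close>.\<close>

definition wedge :: "'e form \<Rightarrow> 'e form \<Rightarrow> 'e form" where
  "wedge \<omega> \<eta> ls = (\<Sum>I\<in>Pow {..<length ls}.
     (- 1) ^ card {(i, k). i \<in> I \<and> k \<in> {..<length ls} - I \<and> k < i} *
     \<omega> (nths ls I) * \<eta> (nths ls (- I)))"

definition form_one :: "'e form" where
  "form_one ls = (if ls = [] then 1 else 0)"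

type_synonym ('a, 'e) fsection = "'a \<Rightarrow> 'e form"

definition ext_sections ::
    "'a cmfd \<Rightarrow> ('a, 'e) vbundle \<Rightarrow> 'a set \<Rightarrow> ('a, 'e) fsection set" where
  "ext_sections M E W = {s \<in> extensional W.
     (\<forall>y\<in>W. s y \<in> ext_alg E y) \<and>
     (\<forall>(U, t)\<in>vb_triv E. \<forall>is. set is \<subseteq> {..<vb_rank E} \<longrightarrow>
        holo_fun M (U \<inter> W) (\<lambda>y. s y (map (coord E t y) is)))}"


section \<open>Superspaces and their morphisms\<close>

text \<open>A space with a sheaf of \<open>\<int>/2\<close>-graded complex algebras; \<open>sp_res S U V\<close> restricts sections
  from \<open>U\<close> to \<open>V \<subseteq> U\<close>.\<close>

record ('a, 's) superspace =
  sp_top :: "'a topology"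
  sp_alg :: "'a set \<Rightarrow> (complex, 's) module"
  sp_res :: "'a set \<Rightarrow> 'a set \<Rightarrow> 's \<Rightarrow> 's"
  sp_even :: "'a set \<Rightarrow> 's set"
  sp_odd :: "'a set \<Rightarrow> 's set"

text \<open>Parity-preserving unital homomorphism of complex superalgebras of sections.\<close>

definition superalg_hom ::
    "('a, 's) superspace \<Rightarrow> 'a set \<Rightarrow> ('b, 't) superspace \<Rightarrow> 'b set \<Rightarrow> ('s \<Rightarrow> 't) \<Rightarrow> bool" where
  "superalg_hom S U S' V h \<longleftrightarrow>
     h \<in> ring_hom (sp_alg S U) (sp_alg S' V) \<and>
     (\<forall>c. \<forall>s\<in>carrier (sp_alg S U). h (c \<odot>\<^bsub>sp_alg S U\<^esub> s) = c \<odot>\<^bsub>sp_alg S' V\<^esub> h s) \<and>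
     h ` sp_even S U \<subseteq> sp_even S' V \<and> h ` sp_odd S U \<subseteq> sp_odd S' V"

text \<open>
  Morphisms of locally ringed superspaces: \<open>fs V\<close> sends sections over \<open>V\<close> to sections over the
  preimage of \<open>V\<close>. The last conjunct says that the maps on stalks are local: a germ that is mapped
  to a unit is a unit.
\<close>

definition superspace_morphism ::
    "('a, 's) superspace \<Rightarrow> ('b, 't) superspace \<Rightarrow> ('a \<Rightarrow> 'b) \<Rightarrow> ('b set \<Rightarrow> 't \<Rightarrow> 's) \<Rightarrow> bool" where
  "superspace_morphism S S' f fs \<longleftrightarrow>
     continuous_map (sp_top S) (sp_top S') f \<and>
     (\<forall>V. openin (sp_top S') V \<longrightarrow> superalg_hom S' V S (preim (sp_top S) f V) (fs V)) \<and>
     (\<forall>V V'. openin (sp_top S') V \<longrightarrow> openin (sp_top S') V' \<longrightarrow> V' \<subseteq> V \<longrightarrow>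
        (\<forall>a\<in>carrier (sp_alg S' V). fs V' (sp_res S' V V' a) =
           sp_res S (preim (sp_top S) f V) (preim (sp_top S) f V') (fs V a))) \<and>
     (\<forall>V. openin (sp_top S') V \<longrightarrow>
        (\<forall>a\<in>carrier (sp_alg S' V). \<forall>y\<in>preim (sp_top S) f V.
           (\<exists>W. openin (sp_top S) W \<and> y \<in> W \<and> W \<subseteq> preim (sp_top S) f V \<and>
              sp_res S (preim (sp_top S) f V) W (fs V a) \<in> Units (sp_alg S W)) \<longrightarrow>
           (\<exists>W'. openin (sp_top S') W' \<and> f y \<in> W' \<and> W' \<subseteq> V \<and>
              sp_res S' V W' a \<in> Units (sp_alg S' W'))))"

definition superspace_isomorphic :: "('a, 's) superspace \<Rightarrow> ('b, 't) superspace \<Rightarrow> bool" where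
  "superspace_isomorphic S S' \<longleftrightarrow>
     (\<exists>f fs. superspace_morphism S S' f fs \<and> homeomorphic_map (sp_top S) (sp_top S') f \<and>
        (\<forall>V. openin (sp_top S') V \<longrightarrow>
           bij_betw (fs V) (carrier (sp_alg S' V)) (carrier (sp_alg S (preim (sp_top S) f V)))))"

text \<open>The split model \<open>S(Y, T\<^sup>*)\<close>: sections of the exterior algebra of the bundle.\<close>

definition ext_section_alg ::
    "'a cmfd \<Rightarrow> ('a, 'e) vbundle \<Rightarrow> 'a set \<Rightarrow> (complex, ('a, 'e) fsection) module" where
  "ext_section_alg M E W = \<lparr>
     carrier = ext_sections M E W,
     monoid.mult = (\<lambda>s s'. \<lambda>y\<in>W. wedge (s y) (s' y)),
     one = (\<lambda>y\<in>W. form_one),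
     zero = (\<lambda>y\<in>W. \<lambda>ls. 0),
     add = (\<lambda>s s'. \<lambda>y\<in>W. \<lambda>ls. s y ls + s' y ls),
     smult = (\<lambda>c s. \<lambda>y\<in>W. \<lambda>ls. c * s y ls)\<rparr>"

definition split_model ::
    "'a cmfd \<Rightarrow> ('a, 'e) vbundle \<Rightarrow> ('a, ('a, 'e) fsection) superspace" where
  "split_model M E = \<lparr>
     sp_top = mtop M,
     sp_alg = ext_section_alg M E,
     sp_res = (\<lambda>U V s. restrict s V),
     sp_even = (\<lambda>W. {s \<in> ext_sections M E W. \<forall>y\<in>W. \<forall>ls. odd (length ls) \<longrightarrow> s y ls = 0}),
     sp_odd = (\<lambda>W. {s \<in> ext_sections M E W. \<forall>y\<in>W. \<forall>ls. even (length ls) \<longrightarrow> s y ls = 0})\<rparr>"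

text \<open>A complex manifold with its (purely even) sheaf of holomorphic functions.\<close>

definition mfd_superspace :: "'a cmfd \<Rightarrow> ('a, 'a \<Rightarrow> complex) superspace" where
  "mfd_superspace M = \<lparr>
     sp_top = mtop M,
     sp_alg = (\<lambda>W. \<lparr>
       carrier = {g \<in> extensional W. holo_fun M W g},
       monoid.mult = (\<lambda>g h. \<lambda>y\<in>W. g y * h y),
       one = (\<lambda>y\<in>W. 1),
       zero = (\<lambda>y\<in>W. 0),
       add = (\<lambda>g h. \<lambda>y\<in>W. g y + h y),
       smult = (\<lambda>c g. \<lambda>y\<in>W. c * g y)\<rparr>),
     sp_res = (\<lambda>U V g. restrict g V),
     sp_even = (\<lambda>W. {g \<in> extensional W. holo_fun M W g}),
     sp_odd = (\<lambda>W. {\<lambda>y\<in>W. 0})\<rparr>"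


section \<open>The first Cech cohomology of a sheaf of groups\<close>

record ('a, 'g) gsheaf =
  gs_grp :: "'a set \<Rightarrow> 'g monoid"
  gs_res :: "'a set \<Rightarrow> 'a set \<Rightarrow> 'g \<Rightarrow> 'g"

text \<open>A covering is a set of open sets, indexed by itself. The values of the 1-cochain outside the
  covering are irrelevant.\<close>

type_synonym ('a, 'g) cochain1 = "'a set set \<times> ('a set \<Rightarrow> 'a set \<Rightarrow> 'g)"

definition cocycles :: "'a topology \<Rightarrow> ('a, 'g) gsheaf \<Rightarrow> ('a, 'g) cochain1 set" where
  "cocycles T F = {(\<U>, g).
     (\<forall>U\<in>\<U>. openin T U) \<and> \<Union> \<U> = topspace T \<and>
     (\<forall>U\<in>\<U>. \<forall>V\<in>\<U>. g U V \<in> carrier (gs_grp F (U \<inter> V))) \<and>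
     (\<forall>U\<in>\<U>. \<forall>V\<in>\<U>. \<forall>W\<in>\<U>.
        gs_res F (U \<inter> V) (U \<inter> V \<inter> W) (g U V) \<otimes>\<^bsub>gs_grp F (U \<inter> V \<inter> W)\<^esub>
          gs_res F (V \<inter> W) (U \<inter> V \<inter> W) (g V W) =
        gs_res F (U \<inter> W) (U \<inter> V \<inter> W) (g U W))}"

text \<open>Two cocycles, possibly on different coverings, are equivalent if they become cohomologous
  after passing to a common refinement \<open>\<W>\<close>, with refinement maps \<open>\<sigma>\<close> and \<open>\<tau>\<close>.\<close>

definition cohomology_rel ::
    "'a topology \<Rightarrow> ('a, 'g) gsheaf \<Rightarrow> (('a, 'g) cochain1 \<times> ('a, 'g) cochain1) set" where
  "cohomology_rel T F = {((\<U>, g), (\<V>, h)).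
     (\<U>, g) \<in> cocycles T F \<and> (\<V>, h) \<in> cocycles T F \<and>
     (\<exists>\<W> \<sigma> \<tau> \<gamma>.
        (\<forall>W\<in>\<W>. openin T W) \<and> \<Union> \<W> = topspace T \<and>
        (\<forall>W\<in>\<W>. \<sigma> W \<in> \<U> \<and> W \<subseteq> \<sigma> W \<and> \<tau> W \<in> \<V> \<and> W \<subseteq> \<tau> W \<and> \<gamma> W \<in> carrier (gs_grp F W)) \<and>
        (\<forall>W\<in>\<W>. \<forall>W'\<in>\<W>.
           gs_res F (\<tau> W \<inter> \<tau> W') (W \<inter> W') (h (\<tau> W) (\<tau> W')) =
             gs_res F W (W \<inter> W') (\<gamma> W) \<otimes>\<^bsub>gs_grp F (W \<inter> W')\<^esub>
             gs_res F (\<sigma> W \<inter> \<sigma> W') (W \<inter> W') (g (\<sigma> W) (\<sigma> W')) \<otimes>\<^bsub>gs_grp F (W \<inter> W')\<^esub>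
             inv\<^bsub>gs_grp F (W \<inter> W')\<^esub> (gs_res F W' (W \<inter> W') (\<gamma> W'))))}"

definition H1 :: "'a topology \<Rightarrow> ('a, 'g) gsheaf \<Rightarrow> ('a, 'g) cochain1 set set" where
  "H1 T F = cocycles T F // cohomology_rel T F"

definition H1_class ::
    "'a topology \<Rightarrow> ('a, 'g) gsheaf \<Rightarrow> ('a, 'g) cochain1 \<Rightarrow> ('a, 'g) cochain1 set" where
  "H1_class T F c = cohomology_rel T F `` {c}"

definition H1_base :: "'a topology \<Rightarrow> ('a, 'g) gsheaf \<Rightarrow> ('a, 'g) cochain1 set" where
  "H1_base T F = H1_class T F ({topspace T}, \<lambda>U V. \<one>\<^bsub>gs_grp F (topspace T)\<^esub>)"

text \<open>
  The map from \<open>H1 TY FY\<close> to \<open>H1 TX FX\<close> induced by a continuous map \<open>i\<close> from \<open>TX\<close> to \<open>TY\<close> and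
  homomorphisms \<open>\<phi> W\<close> from sections of \<open>FY\<close> over \<open>W\<close> to sections of \<open>FX\<close> over the preimage of
  \<open>W\<close>. Since preimages of distinct members of \<open>\<U>\<close> may coincide, the pulled-back cocycle is taken
  along a choice \<open>\<tau>\<close> of members of \<open>\<U>\<close>.
\<close>

definition H1_map ::
    "'x topology \<Rightarrow> ('x, 'h) gsheaf \<Rightarrow> ('y, 'g) gsheaf \<Rightarrow> ('x \<Rightarrow> 'y) \<Rightarrow> ('y set \<Rightarrow> 'g \<Rightarrow> 'h) \<Rightarrow>
     ('y, 'g) cochain1 set \<Rightarrow> ('x, 'h) cochain1 set" where
  "H1_map TX FX FY i \<phi> c = (\<Union>(\<U>, g)\<in>c. cohomology_rel TX FX `` {(\<V>, h).
     (\<V>, h) \<in> cocycles TX FX \<and>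
     (\<exists>\<tau>. (\<forall>V\<in>\<V>. \<tau> V \<in> \<U> \<and> i ` V \<subseteq> \<tau> V) \<and>
        (\<forall>V\<in>\<V>. \<forall>V'\<in>\<V>. h V V' =
           gs_res FX (preim TX i (\<tau> V \<inter> \<tau> V')) (V \<inter> V') (\<phi> (\<tau> V \<inter> \<tau> V') (g (\<tau> V) (\<tau> V')))))})"


section \<open>Supermanifolds\<close>

text \<open>
  An automorphism over \<open>W\<close> of the sheaf of superalgebras of \<open>S\<close> is a family of automorphisms of
  the algebras of sections over all open \<open>V \<subseteq> W\<close> compatible with restrictions.
\<close>

type_synonym ('a, 's) sheaf_aut = "'a set \<Rightarrow> 's \<Rightarrow> 's"

definition opens_in :: "('a, 's) superspace \<Rightarrow> 'a set \<Rightarrow> 'a set set" where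
  "opens_in S W = {V. openin (sp_top S) V \<and> V \<subseteq> W}"

definition sheaf_auts :: "('a, 's) superspace \<Rightarrow> 'a set \<Rightarrow> ('a, 's) sheaf_aut set" where
  "sheaf_auts S W = {\<alpha> \<in> extensional (opens_in S W).
     (\<forall>V\<in>opens_in S W.
        \<alpha> V \<in> extensional (carrier (sp_alg S V)) \<and> superalg_hom S V S V (\<alpha> V) \<and>
        bij_betw (\<alpha> V) (carrier (sp_alg S V)) (carrier (sp_alg S V))) \<and>
     (\<forall>V\<in>opens_in S W. \<forall>V'\<in>opens_in S V. \<forall>s\<in>carrier (sp_alg S V).
        \<alpha> V' (sp_res S V V' s) = sp_res S V V' (\<alpha> V s))}"

definition sheaf_aut_group :: "('a, 's) superspace \<Rightarrow> 'a set \<Rightarrow> ('a, 's) sheaf_aut monoid" where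
  "sheaf_aut_group S W = \<lparr>
     carrier = sheaf_auts S W,
     monoid.mult = (\<lambda>\<alpha> \<beta>. \<lambda>V\<in>opens_in S W. compose (carrier (sp_alg S V)) (\<alpha> V) (\<beta> V)),
     one = (\<lambda>V\<in>opens_in S W. \<lambda>s\<in>carrier (sp_alg S V). s)\<rparr>"

text \<open>The sheaf \<open>\<G>\<^sup>(\<^sup>j\<^sup>)\<close>: the condition says that \<open>\<alpha> V u - u\<close> has no component of degree below \<open>j\<close>.
  For \<open>j = \<infinity>\<close> it is the trivial sheaf.\<close>

definition G_carrier ::
    "'a cmfd \<Rightarrow> ('a, 'e) vbundle \<Rightarrow> enat \<Rightarrow> 'a set \<Rightarrow> ('a, ('a, 'e) fsection) sheaf_aut set" where
  "G_carrier M E j W = {\<alpha> \<in> sheaf_auts (split_model M E) W.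
     \<forall>V\<in>opens_in (split_model M E) W. \<forall>u\<in>ext_sections M E V. \<forall>y\<in>V. \<forall>ls.
       enat (length ls) < j \<longrightarrow> \<alpha> V u y ls - u y ls = 0}"

definition aut_gsheaf ::
    "('a, 's) superspace \<Rightarrow> ('a set \<Rightarrow> ('a, 's) sheaf_aut set) \<Rightarrow> ('a, ('a, 's) sheaf_aut) gsheaf" where
  "aut_gsheaf S C = \<lparr>
     gs_grp = (\<lambda>W. (sheaf_aut_group S W)\<lparr>carrier := C W\<rparr>),
     gs_res = (\<lambda>W W' \<alpha>. restrict \<alpha> (opens_in S W'))\<rparr>"

definition G_sheaf ::
    "'a cmfd \<Rightarrow> ('a, 'e) vbundle \<Rightarrow> enat \<Rightarrow> ('a, ('a, ('a, 'e) fsection) sheaf_aut) gsheaf" where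
  "G_sheaf M E j = aut_gsheaf (split_model M E) (G_carrier M E j)"

text \<open>The map on cohomology induced by the inclusion of \<open>\<G>\<^sup>(\<^sup>j\<^sup>)\<close> into \<open>\<G>\<^sup>(\<^sup>k\<^sup>)\<close> for \<open>k \<le> j\<close>.\<close>

definition level_map ::
    "'a cmfd \<Rightarrow> ('a, 'e) vbundle \<Rightarrow> enat \<Rightarrow> enat \<Rightarrow>
     ('a, ('a, ('a, 'e) fsection) sheaf_aut) cochain1 set \<Rightarrow>
     ('a, ('a, ('a, 'e) fsection) sheaf_aut) cochain1 set" where
  "level_map M E j k = H1_map (mtop M) (G_sheaf M E k) (G_sheaf M E j) (\<lambda>y. y) (\<lambda>W \<alpha>. \<alpha>)"

definition is_model :: "'a cmfd \<Rightarrow> ('a, 'e) vbundle \<Rightarrow> bool" where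
  "is_model M E \<longleftrightarrow> complex_manifold M \<and> holo_vbundle M E"

type_synonym ('a, 'e) gluing_data = "('a, ('a, ('a, 'e) fsection) sheaf_aut) cochain1"

definition sm_class ::
    "'a cmfd \<Rightarrow> ('a, 'e) vbundle \<Rightarrow> enat \<Rightarrow> ('a, 'e) gluing_data \<Rightarrow> ('a, 'e) gluing_data set" where
  "sm_class M E j S = H1_class (mtop M) (G_sheaf M E j) S"

text \<open>
  A supermanifold of splitting type \<open>j\<close> modelled on \<open>(M, E)\<close>, given by a cocycle representing its
  class. The last conjunct says that for finite \<open>j\<close> it does not have splitting type \<open>j + 1\<close>, i.e. its
  class does not lift; in particular a finite \<open>j\<close> is at most the rank, as beyond it
  all the sheaves are trivial.
\<close>

definition supermanifold ::
    "'a cmfd \<Rightarrow> ('a, 'e) vbundle \<Rightarrow> enat \<Rightarrow> ('a, 'e) gluing_data \<Rightarrow> bool" where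
  "supermanifold M E j S \<longleftrightarrow>
     is_model M E \<and> 2 \<le> j \<and> S \<in> cocycles (mtop M) (G_sheaf M E j) \<and>
     (j \<noteq> \<infinity> \<longrightarrow> \<not> (\<exists>d\<in>H1 (mtop M) (G_sheaf M E (eSuc j)).
        level_map M E (eSuc j) j d = sm_class M E j S))"

text \<open>
  The locally ringed superspace glued from the restrictions of the exterior algebra sheaf to the
  members \<open>U\<close> of the covering: a section over \<open>W\<close> is a family of sections over \<open>W \<inter> U\<close> which are
  matched by \<open>g\<close> on overlaps.
\<close>

definition glue_sections ::
    "'a cmfd \<Rightarrow> ('a, 'e) vbundle \<Rightarrow> ('a, 'e) gluing_data \<Rightarrow> 'a set \<Rightarrow>
     ('a set \<Rightarrow> ('a, 'e) fsection) set" where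
  "glue_sections M E = (\<lambda>(\<U>, g) W. {s \<in> (\<Pi>\<^sub>E U\<in>\<U>. ext_sections M E (W \<inter> U)).
     \<forall>U\<in>\<U>. \<forall>V\<in>\<U>. restrict (s U) (W \<inter> U \<inter> V) =
       g U V (W \<inter> U \<inter> V) (restrict (s V) (W \<inter> U \<inter> V))})"

definition glued_superspace ::
    "'a cmfd \<Rightarrow> ('a, 'e) vbundle \<Rightarrow> ('a, 'e) gluing_data \<Rightarrow>
     ('a, 'a set \<Rightarrow> ('a, 'e) fsection) superspace" where
  "glued_superspace M E S = \<lparr>
     sp_top = mtop M,
     sp_alg = (\<lambda>W. \<lparr>
       carrier = glue_sections M E S W,
       monoid.mult = (\<lambda>s s'. \<lambda>U\<in>fst S. s U \<otimes>\<^bsub>ext_section_alg M E (W \<inter> U)\<^esub> s' U),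
       one = (\<lambda>U\<in>fst S. \<one>\<^bsub>ext_section_alg M E (W \<inter> U)\<^esub>),
       zero = (\<lambda>U\<in>fst S. \<zero>\<^bsub>ext_section_alg M E (W \<inter> U)\<^esub>),
       add = (\<lambda>s s'. \<lambda>U\<in>fst S. s U \<oplus>\<^bsub>ext_section_alg M E (W \<inter> U)\<^esub> s' U),
       smult = (\<lambda>c s. \<lambda>U\<in>fst S. c \<odot>\<^bsub>ext_section_alg M E (W \<inter> U)\<^esub> s U)\<rparr>),
     sp_res = (\<lambda>W W' s. \<lambda>U\<in>fst S. restrict (s U) (W' \<inter> U)),
     sp_even = (\<lambda>W. {s \<in> glue_sections M E S W.
       \<forall>U\<in>fst S. s U \<in> sp_even (split_model M E) (W \<inter> U)}),
     sp_odd = (\<lambda>W. {s \<in> glue_sections M E S W.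
       \<forall>U\<in>fst S. s U \<in> sp_odd (split_model M E) (W \<inter> U)})\<rparr>"

definition sm_split :: "'a cmfd \<Rightarrow> ('a, 'e) vbundle \<Rightarrow> ('a, 'e) gluing_data \<Rightarrow> bool" where
  "sm_split M E S \<longleftrightarrow> superspace_isomorphic (glued_superspace M E S) (split_model M E)"


section \<open>Embeddings\<close>

text \<open>\<open>p x\<close> is the surjection from the fibre of \<open>VY\<close> over \<open>i x\<close> to the fibre of \<open>VX\<close> over \<open>x\<close>.\<close>

definition model_embedding ::
    "'x cmfd \<Rightarrow> ('x, 'd) vbundle \<Rightarrow> 'y cmfd \<Rightarrow> ('y, 'e) vbundle \<Rightarrow>
     ('x \<Rightarrow> 'y) \<Rightarrow> ('x \<Rightarrow> 'e \<Rightarrow> 'd) \<Rightarrow> bool" where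
  "model_embedding X VX Y VY i p \<longleftrightarrow>
     is_model X VX \<and> is_model Y VY \<and> submanifold_inclusion X Y i \<and>
     (\<forall>x\<in>topspace (mtop X). p x ` fibre VY (i x) = fibre VX x) \<and>
     (\<forall>(U, t)\<in>vb_triv VY. \<forall>(V, s)\<in>vb_triv VX. \<exists>A :: 'x \<Rightarrow> nat \<Rightarrow> nat \<Rightarrow> complex.
        (\<forall>k<vb_rank VX. \<forall>l<vb_rank VY.
           holo_fun X (V \<inter> preim (mtop X) i U) (\<lambda>x. A x k l)) \<and>
        (\<forall>x\<in>V \<inter> preim (mtop X) i U. \<forall>e\<in>fibre VY (i x). \<forall>k<vb_rank VX.
           s (p x e) k = (\<Sum>l<vb_rank VY. A x k l * t e l)))"

text \<open>The homomorphism of exterior algebra sheaves induced by an embedding of models: restrict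
  to \<open>X\<close> and apply the exterior algebra of \<open>p x\<close>, which on alternating forms is precomposition
  with the transpose of \<open>p x\<close>.\<close>

definition restr_sections ::
    "'x cmfd \<Rightarrow> ('x, 'd) vbundle \<Rightarrow> ('y, 'e) vbundle \<Rightarrow> ('x \<Rightarrow> 'y) \<Rightarrow> ('x \<Rightarrow> 'e \<Rightarrow> 'd) \<Rightarrow>
     'y set \<Rightarrow> ('y, 'e) fsection \<Rightarrow> ('x, 'd) fsection" where
  "restr_sections X VX VY i p W s = (\<lambda>x\<in>preim (mtop X) i W. \<lambda>ls.
     if set ls \<subseteq> fdual VX x
     then s (i x) (map (\<lambda>l. restrict (\<lambda>e. l (p x e)) (fibre VY (i x))) ls)
     else 0)"

text \<open>\<open>\<beta>\<close> over the preimage of \<open>W\<close> is the restriction of \<open>\<alpha>\<close> over \<open>W\<close>.\<close>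

definition restricts_to ::
    "'x cmfd \<Rightarrow> ('x, 'd) vbundle \<Rightarrow> 'y cmfd \<Rightarrow> ('y, 'e) vbundle \<Rightarrow>
     ('x \<Rightarrow> 'y) \<Rightarrow> ('x \<Rightarrow> 'e \<Rightarrow> 'd) \<Rightarrow> 'y set \<Rightarrow>
     ('y, ('y, 'e) fsection) sheaf_aut \<Rightarrow> ('x, ('x, 'd) fsection) sheaf_aut \<Rightarrow> bool" where
  "restricts_to X VX Y VY i p W \<alpha> \<beta> \<longleftrightarrow>
     (\<forall>V\<in>opens_in (split_model Y VY) W. \<forall>u\<in>ext_sections Y VY V.
        \<beta> (preim (mtop X) i V) (restr_sections X VX VY i p V u) =
          restr_sections X VX VY i p V (\<alpha> V u))"

definition rel_G_sheaf ::
    "'x cmfd \<Rightarrow> ('x, 'd) vbundle \<Rightarrow> 'y cmfd \<Rightarrow> ('y, 'e) vbundle \<Rightarrow>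
     ('x \<Rightarrow> 'y) \<Rightarrow> ('x \<Rightarrow> 'e \<Rightarrow> 'd) \<Rightarrow> enat \<Rightarrow>
     ('y, ('y, ('y, 'e) fsection) sheaf_aut) gsheaf" where
  "rel_G_sheaf X VX Y VY i p j = aut_gsheaf (split_model Y VY)
     (\<lambda>W. {\<alpha> \<in> G_carrier Y VY j W.
        \<exists>\<beta>\<in>G_carrier X VX j (preim (mtop X) i W). restricts_to X VX Y VY i p W \<alpha> \<beta>})"

text \<open>The restriction is unique, because \<open>restr_sections\<close> is an epimorphism of sheaves.\<close>

definition restr_aut ::
    "'x cmfd \<Rightarrow> ('x, 'd) vbundle \<Rightarrow> 'y cmfd \<Rightarrow> ('y, 'e) vbundle \<Rightarrow>
     ('x \<Rightarrow> 'y) \<Rightarrow> ('x \<Rightarrow> 'e \<Rightarrow> 'd) \<Rightarrow> enat \<Rightarrow> 'y set \<Rightarrow>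
     ('y, ('y, 'e) fsection) sheaf_aut \<Rightarrow> ('x, ('x, 'd) fsection) sheaf_aut" where
  "restr_aut X VX Y VY i p j W \<alpha> =
     (THE \<beta>. \<beta> \<in> G_carrier X VX j (preim (mtop X) i W) \<and> restricts_to X VX Y VY i p W \<alpha> \<beta>)"

definition u_star ::
    "'x cmfd \<Rightarrow> ('x, 'd) vbundle \<Rightarrow> 'y cmfd \<Rightarrow> ('y, 'e) vbundle \<Rightarrow>
     ('x \<Rightarrow> 'y) \<Rightarrow> ('x \<Rightarrow> 'e \<Rightarrow> 'd) \<Rightarrow> enat \<Rightarrow> ('y, 'e) gluing_data set \<Rightarrow> ('y, 'e) gluing_data set" where
  "u_star X VX Y VY i p j =
     H1_map (mtop Y) (G_sheaf Y VY j) (rel_G_sheaf X VX Y VY i p j) (\<lambda>y. y) (\<lambda>W \<alpha>. \<alpha>)"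

definition r_star ::
    "'x cmfd \<Rightarrow> ('x, 'd) vbundle \<Rightarrow> 'y cmfd \<Rightarrow> ('y, 'e) vbundle \<Rightarrow>
     ('x \<Rightarrow> 'y) \<Rightarrow> ('x \<Rightarrow> 'e \<Rightarrow> 'd) \<Rightarrow> enat \<Rightarrow> ('y, 'e) gluing_data set \<Rightarrow> ('x, 'd) gluing_data set" where
  "r_star X VX Y VY i p j =
     H1_map (mtop X) (G_sheaf X VX j) (rel_G_sheaf X VX Y VY i p j) i (restr_aut X VX Y VY i p j)"

text \<open>The class \<open>c\<close> is an embedding of splitting type \<open>(k, j, j')\<close> of the supermanifold \<open>S\<close> of
  splitting type \<open>j\<close> in the supermanifold \<open>S'\<close> of splitting type \<open>j'\<close>.\<close>

definition embedding_class ::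
    "'x cmfd \<Rightarrow> ('x, 'd) vbundle \<Rightarrow> 'y cmfd \<Rightarrow> ('y, 'e) vbundle \<Rightarrow>
     ('x \<Rightarrow> 'y) \<Rightarrow> ('x \<Rightarrow> 'e \<Rightarrow> 'd) \<Rightarrow> enat \<Rightarrow> enat \<Rightarrow> enat \<Rightarrow>
     ('x, 'd) gluing_data \<Rightarrow> ('y, 'e) gluing_data \<Rightarrow> ('y, 'e) gluing_data set \<Rightarrow> bool" where
  "embedding_class X VX Y VY i p k j j' S S' c \<longleftrightarrow>
     model_embedding X VX Y VY i p \<and> 2 \<le> k \<and> k \<le> j \<and> k \<le> j' \<and>
     c \<in> H1 (mtop Y) (rel_G_sheaf X VX Y VY i p k) \<and>
     r_star X VX Y VY i p k c = level_map X VX j k (sm_class X VX j S) \<and>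
     u_star X VX Y VY i p k c = level_map Y VY j' k (sm_class Y VY j' S')"


section \<open>Families and splitting type deformations\<close>

record ('x, 'd, 'y, 'e) family_fibre =
  fib_type :: enat
  fib_sm :: "('x, 'd) gluing_data"
  fib_incl :: "'x \<Rightarrow> 'y"
  fib_surj :: "'x \<Rightarrow> 'e \<Rightarrow> 'd"
  fib_level :: enat
  fib_class :: "('y, 'e) gluing_data set"

text \<open>
  The embedding of models underlying the embedding of the fibre over \<open>b\<close> may depend on \<open>b\<close>. Nothing
  is demanded of its position relative to the fibre of \<open>f\<close> over \<open>b\<close>, so that in particular
  the families with \<open>fib_incl (F b)\<close> mapping onto that fibre are covered.
\<close>

definition supermanifold_family ::
    "'x cmfd \<Rightarrow> ('x, 'd) vbundle \<Rightarrow> 'y cmfd \<Rightarrow> ('y, 'e) vbundle \<Rightarrow> 'b cmfd \<Rightarrow>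
     enat \<Rightarrow> ('y, 'e) gluing_data \<Rightarrow>
     ('y \<Rightarrow> 'b) \<Rightarrow> ('b set \<Rightarrow> ('b \<Rightarrow> complex) \<Rightarrow> 'y set \<Rightarrow> ('y, 'e) fsection) \<Rightarrow>
     ('b \<Rightarrow> ('x, 'd, 'y, 'e) family_fibre) \<Rightarrow> bool" where
  "supermanifold_family X VX Y VY B j' S f fs F \<longleftrightarrow>
     complex_manifold B \<and> is_model X VX \<and> supermanifold Y VY j' S \<and>
     superspace_morphism (glued_superspace Y VY S) (mfd_superspace B) f fs \<and>
     analytic_family Y B f \<and>
     (\<forall>b\<in>topspace (mtop B).
        supermanifold X VX (fib_type (F b)) (fib_sm (F b)) \<and>
        embedding_class X VX Y VY (fib_incl (F b)) (fib_surj (F b))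
          (fib_level (F b)) (fib_type (F b)) j' (fib_sm (F b)) S (fib_class (F b)))"

definition splitting_type_deformation ::
    "'x cmfd \<Rightarrow> ('x, 'd) vbundle \<Rightarrow> 'y cmfd \<Rightarrow> ('y, 'e) vbundle \<Rightarrow> 'b cmfd \<Rightarrow> 'b \<Rightarrow>
     enat \<Rightarrow> ('y, 'e) gluing_data \<Rightarrow>
     ('y \<Rightarrow> 'b) \<Rightarrow> ('b set \<Rightarrow> ('b \<Rightarrow> complex) \<Rightarrow> 'y set \<Rightarrow> ('y, 'e) fsection) \<Rightarrow>
     ('b \<Rightarrow> ('x, 'd, 'y, 'e) family_fibre) \<Rightarrow> bool" where
  "splitting_type_deformation X VX Y VY B b0 j' S f fs F \<longleftrightarrow>
     supermanifold_family X VX Y VY B j' S f fs F \<and> b0 \<in> topspace (mtop B)"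

definition represents_split_embedding ::
    "'x cmfd \<Rightarrow> ('x, 'd) vbundle \<Rightarrow> 'y cmfd \<Rightarrow> ('y, 'e) vbundle \<Rightarrow>
     ('x, 'd, 'y, 'e) family_fibre \<Rightarrow> bool" where
  "represents_split_embedding X VX Y VY Fb \<longleftrightarrow>
     fib_class Fb =
       H1_base (mtop Y) (rel_G_sheaf X VX Y VY (fib_incl Fb) (fib_surj Fb) (fib_level Fb))"

end

theory Submission
  imports Defs
begin

text \<open>
  Forgetting the restriction to \<open>X\<close> maps the base-point to the base-point, so the class of the total
  space becomes trivial at level \<open>j''\<close>: its cocycle is a coboundary of automorphisms of the exterior
  algebra sheaf. Such a 0-cochain is an isomorphism from the split model onto the glued space.
\<close>

section \<open>Cohomologous cocycles of automorphisms\<close>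

text \<open>The products of two sections are not assumed to be sections, so that reflecting the relation
  \<open>s s' = 1\<close> does not follow from bijectivity and is required separately. It makes the comorphism local.\<close>

definition local_aut :: "('a, 's) superspace \<Rightarrow> 'a set \<Rightarrow> ('a, 's) sheaf_aut \<Rightarrow> bool" where
  "local_aut S W \<alpha> \<longleftrightarrow>
     (\<forall>V\<in>opens_in S W. superalg_hom S V S V (\<alpha> V) \<and>
        bij_betw (\<alpha> V) (carrier (sp_alg S V)) (carrier (sp_alg S V)) \<and>
        (\<forall>s\<in>carrier (sp_alg S V). \<forall>s'\<in>carrier (sp_alg S V).
           \<alpha> V s \<otimes>\<^bsub>sp_alg S V\<^esub> \<alpha> V s' = \<one>\<^bsub>sp_alg S V\<^esub> \<longrightarrow> s \<otimes>\<^bsub>sp_alg S V\<^esub> s' = \<one>\<^bsub>sp_alg S V\<^esub>)) \<and>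
     (\<forall>V\<in>opens_in S W. \<forall>V'\<in>opens_in S V. \<forall>s\<in>carrier (sp_alg S V).
        \<alpha> V' (sp_res S V V' s) = sp_res S V V' (\<alpha> V s))"

definition aut_cocycle ::
    "('a, 's) superspace \<Rightarrow> 'a set set \<Rightarrow> ('a set \<Rightarrow> 'a set \<Rightarrow> ('a, 's) sheaf_aut) \<Rightarrow> bool" where
  "aut_cocycle S \<U> g \<longleftrightarrow>
     (\<forall>U\<in>\<U>. openin (sp_top S) U) \<and>
     (\<forall>U\<in>\<U>. \<forall>V\<in>\<U>. local_aut S (U \<inter> V) (g U V)) \<and>
     (\<forall>U\<in>\<U>. \<forall>V\<in>\<U>. \<forall>W\<in>\<U>. \<forall>P\<in>opens_in S (U \<inter> V \<inter> W). \<forall>s\<in>carrier (sp_alg S P).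
        g U V P (g V W P s) = g U W P s)"

text \<open>Refinements are indexed by points, which avoids choosing members of a common refinement;
  the relation is stated without inverses.\<close>

definition aut_cohomologous ::
    "('a, 's) superspace \<Rightarrow> ('a, ('a, 's) sheaf_aut) cochain1 \<Rightarrow>
     ('a, ('a, 's) sheaf_aut) cochain1 \<Rightarrow> bool" where
  "aut_cohomologous S = (\<lambda>(\<A>, g) (\<B>, h). \<exists>w a b \<gamma>. \<forall>y\<in>topspace (sp_top S).
     y \<in> w y \<and> openin (sp_top S) (w y) \<and> a y \<in> \<A> \<and> w y \<subseteq> a y \<and> b y \<in> \<B> \<and> w y \<subseteq> b y \<and>
     local_aut S (w y) (\<gamma> y) \<and>
     (\<forall>x\<in>topspace (sp_top S). \<forall>P\<in>opens_in S (w x \<inter> w y). \<forall>s\<in>carrier (sp_alg S P).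
        h (b x) (b y) P (\<gamma> y P s) = \<gamma> x P (g (a x) (a y) P s)))"

lemma superalg_hom_id: "superalg_hom S V S V (\<lambda>s. s)"
  by (auto simp: superalg_hom_def ring_hom_def)

lemma superalg_hom_compose:
  assumes "superalg_hom S U S' V h" "superalg_hom S' V S'' W k"
  shows "superalg_hom S U S'' W (\<lambda>s. k (h s))"
  using assms unfolding superalg_hom_def ring_hom_def by (auto simp: image_subset_iff Pi_iff)

lemma opens_in_trans: "P \<in> opens_in S V \<Longrightarrow> V \<subseteq> W \<Longrightarrow> P \<in> opens_in S W"
  by (auto simp: opens_in_def)

lemma opens_in_Int: "P \<in> opens_in S (V \<inter> W) \<longleftrightarrow> P \<in> opens_in S V \<and> P \<in> opens_in S W"
  by (auto simp: opens_in_def)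

lemma local_aut_mono: "local_aut S W \<alpha> \<Longrightarrow> W' \<subseteq> W \<Longrightarrow> local_aut S W' \<alpha>"
  unfolding local_aut_def by (meson opens_in_trans)

lemma local_aut_id: "local_aut S W (\<lambda>V s. s)"
  by (auto simp: local_aut_def superalg_hom_id bij_betw_id[unfolded id_def])

lemma local_aut_carrier:
  "local_aut S W \<alpha> \<Longrightarrow> V \<in> opens_in S W \<Longrightarrow> s \<in> carrier (sp_alg S V) \<Longrightarrow> \<alpha> V s \<in> carrier (sp_alg S V)"
  unfolding local_aut_def by (meson bij_betwE)

lemma local_aut_inj:
  "local_aut S W \<alpha> \<Longrightarrow> V \<in> opens_in S W \<Longrightarrow> s \<in> carrier (sp_alg S V) \<Longrightarrow>
   s' \<in> carrier (sp_alg S V) \<Longrightarrow> \<alpha> V s = \<alpha> V s' \<longleftrightarrow> s = s'"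
  unfolding local_aut_def by (meson bij_betw_def inj_on_eq_iff)

lemma local_aut_compose:
  assumes \<alpha>: "local_aut S W \<alpha>" and \<beta>: "local_aut S W \<beta>"
  shows "local_aut S W (\<lambda>V s. \<alpha> V (\<beta> V s))"
  unfolding local_aut_def
proof (intro conjI ballI impI)
  fix V assume V: "V \<in> opens_in S W"
  show "superalg_hom S V S V (\<lambda>s. \<alpha> V (\<beta> V s))"
    using \<alpha> \<beta> V superalg_hom_compose unfolding local_aut_def by blast
  show "bij_betw (\<lambda>s. \<alpha> V (\<beta> V s)) (carrier (sp_alg S V)) (carrier (sp_alg S V))"
    using \<alpha> \<beta> V bij_betw_trans[of "\<beta> V" _ _ "\<alpha> V"] unfolding local_aut_def comp_def by blast
  fix s s' assume s: "s \<in> carrier (sp_alg S V)" "s' \<in> carrier (sp_alg S V)"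
    and *: "\<alpha> V (\<beta> V s) \<otimes>\<^bsub>sp_alg S V\<^esub> \<alpha> V (\<beta> V s') = \<one>\<^bsub>sp_alg S V\<^esub>"
  have "\<beta> V s \<in> carrier (sp_alg S V)" "\<beta> V s' \<in> carrier (sp_alg S V)"
    using local_aut_carrier[OF \<beta> V] s by auto
  with * \<alpha> V have "\<beta> V s \<otimes>\<^bsub>sp_alg S V\<^esub> \<beta> V s' = \<one>\<^bsub>sp_alg S V\<^esub>"
    unfolding local_aut_def by blast
  with \<beta> V s show "s \<otimes>\<^bsub>sp_alg S V\<^esub> s' = \<one>\<^bsub>sp_alg S V\<^esub>"
    unfolding local_aut_def by blast
next
  fix V V' s assume V: "V \<in> opens_in S W" and V': "V' \<in> opens_in S V"
    and s: "s \<in> carrier (sp_alg S V)"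
  have "\<beta> V s \<in> carrier (sp_alg S V)"
    using \<beta> V s by (rule local_aut_carrier)
  then show "\<alpha> V' (\<beta> V' (sp_res S V V' s)) = sp_res S V V' (\<alpha> V (\<beta> V s))"
    using \<alpha> \<beta> V V' s unfolding local_aut_def by simp
qed

lemma aut_cocycle_diag:
  assumes "aut_cocycle S \<U> g" "U \<in> \<U>" "P \<in> opens_in S U" "s \<in> carrier (sp_alg S P)"
  shows "g U U P s = s"
proof -
  have l: "local_aut S U (g U U)"
    using assms unfolding aut_cocycle_def by (metis Int_absorb)
  have "g U U P (g U U P s) = g U U P s"
    using assms unfolding aut_cocycle_def by (metis Int_absorb)
  moreover have "g U U P s \<in> carrier (sp_alg S P)"
    using l assms by (blast intro: local_aut_carrier)
  ultimately show ?thesis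
    using local_aut_inj[OF l assms(3) _ assms(4)] by blast
qed

lemma aut_cohomologous_trans:
  assumes gh: "aut_cohomologous S (\<A>, g) (\<B>, h)" and h: "aut_cocycle S \<B> h"
    and hk: "aut_cohomologous S (\<B>, h) (\<C>, k)"
  shows "aut_cohomologous S (\<A>, g) (\<C>, k)"
proof -
  let ?X = "topspace (sp_top S)"
  obtain w a b \<gamma> where 1: "\<forall>y\<in>?X.
     y \<in> w y \<and> openin (sp_top S) (w y) \<and> a y \<in> \<A> \<and> w y \<subseteq> a y \<and> b y \<in> \<B> \<and> w y \<subseteq> b y \<and>
     local_aut S (w y) (\<gamma> y) \<and>
     (\<forall>x\<in>?X. \<forall>P\<in>opens_in S (w x \<inter> w y). \<forall>s\<in>carrier (sp_alg S P).
        h (b x) (b y) P (\<gamma> y P s) = \<gamma> x P (g (a x) (a y) P s))"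
    using gh unfolding aut_cohomologous_def by auto
  obtain v b' c \<delta> where 2: "\<forall>y\<in>?X.
     y \<in> v y \<and> openin (sp_top S) (v y) \<and> b' y \<in> \<B> \<and> v y \<subseteq> b' y \<and> c y \<in> \<C> \<and> v y \<subseteq> c y \<and>
     local_aut S (v y) (\<delta> y) \<and>
     (\<forall>x\<in>?X. \<forall>P\<in>opens_in S (v x \<inter> v y). \<forall>s\<in>carrier (sp_alg S P).
        k (c x) (c y) P (\<delta> y P s) = \<delta> x P (h (b' x) (b' y) P s))"
    using hk unfolding aut_cohomologous_def by auto
  have w: "y \<in> w y" "openin (sp_top S) (w y)" "a y \<in> \<A>" "w y \<subseteq> a y" "b y \<in> \<B>" "w y \<subseteq> b y"
      "local_aut S (w y) (\<gamma> y)"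
    and v: "y \<in> v y" "openin (sp_top S) (v y)" "b' y \<in> \<B>" "v y \<subseteq> b' y" "c y \<in> \<C>" "v y \<subseteq> c y"
      "local_aut S (v y) (\<delta> y)" if "y \<in> ?X" for y
    using bspec[OF 1 that] bspec[OF 2 that] by blast+
  have \<gamma>: "h (b x) (b y) P (\<gamma> y P s) = \<gamma> x P (g (a x) (a y) P s)"
    if "x \<in> ?X" "y \<in> ?X" "P \<in> opens_in S (w x)" "P \<in> opens_in S (w y)" "s \<in> carrier (sp_alg S P)"
    for x y P s
    using that(3-) bspec[OF 1 that(2)] that(1) by (simp only: opens_in_Int Ball_def simp_thms)
  have \<delta>: "k (c x) (c y) P (\<delta> y P s) = \<delta> x P (h (b' x) (b' y) P s)"
    if "x \<in> ?X" "y \<in> ?X" "P \<in> opens_in S (v x)" "P \<in> opens_in S (v y)" "s \<in> carrier (sp_alg S P)"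
    for x y P s
    using that(3-) bspec[OF 2 that(2)] that(1) by (simp only: opens_in_Int Ball_def simp_thms)
  have coc: "h U V P (h V W P s) = h U W P s"
    if "U \<in> \<B>" "V \<in> \<B>" "W \<in> \<B>" "P \<in> opens_in S U" "P \<in> opens_in S V" "P \<in> opens_in S W"
      "s \<in> carrier (sp_alg S P)" for U V W P s
    using h that unfolding aut_cocycle_def by (simp add: opens_in_Int)
  have h_aut: "local_aut S (U \<inter> V) (h U V)" if "U \<in> \<B>" "V \<in> \<B>" for U V
    using h that unfolding aut_cocycle_def by blast
  let ?\<epsilon> = "\<lambda>y P s. \<delta> y P (h (b' y) (b y) P (\<gamma> y P s))"
  have aut: "local_aut S (w y \<inter> v y) (?\<epsilon> y)" if y: "y \<in> ?X" for y
  proof -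
    have "local_aut S (w y \<inter> v y) (h (b' y) (b y))"
      using h_aut[OF v(3)[OF y] w(5)[OF y]] by (rule local_aut_mono) (use w(6)[OF y] v(4)[OF y] in auto)
    then show ?thesis
      using local_aut_compose[OF local_aut_mono[OF v(7)[OF y] Int_lower2]
        local_aut_compose[OF _ local_aut_mono[OF w(7)[OF y] Int_lower1]]] by blast
  qed
  have eq: "k (c x) (c y) P (?\<epsilon> y P s) = ?\<epsilon> x P (g (a x) (a y) P s)"
    if x: "x \<in> ?X" and y: "y \<in> ?X" and "P \<in> opens_in S ((w x \<inter> v x) \<inter> (w y \<inter> v y))"
      and s: "s \<in> carrier (sp_alg S P)" for x y P s
  proof -
    have P: "P \<in> opens_in S (w x)" "P \<in> opens_in S (v x)" "P \<in> opens_in S (w y)" "P \<in> opens_in S (v y)"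
      using that(3) by (auto simp: opens_in_Int)
    have Pb: "P \<in> opens_in S (b x)" "P \<in> opens_in S (b' x)" "P \<in> opens_in S (b y)" "P \<in> opens_in S (b' y)"
      using opens_in_trans P w(6) v(4) x y by metis+
    note B = w(5)[OF x] v(3)[OF x] w(5)[OF y] v(3)[OF y]
    have \<gamma>s: "\<gamma> y P s \<in> carrier (sp_alg S P)"
      using local_aut_carrier[OF w(7)[OF y] P(3) s] .
    have "k (c x) (c y) P (?\<epsilon> y P s) = \<delta> x P (h (b' x) (b' y) P (h (b' y) (b y) P (\<gamma> y P s)))"
      by (rule \<delta>[OF x y P(2,4)], rule local_aut_carrier[OF h_aut[OF B(4,3)] _ \<gamma>s])
        (use Pb in \<open>simp add: opens_in_Int\<close>)
    also have "h (b' x) (b' y) P (h (b' y) (b y) P (\<gamma> y P s)) = h (b' x) (b y) P (\<gamma> y P s)"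
      by (rule coc[OF B(2,4,3) Pb(2,4,3) \<gamma>s])
    also have "\<dots> = h (b' x) (b x) P (h (b x) (b y) P (\<gamma> y P s))"
      by (rule coc[OF B(2,1,3) Pb(2,1,3) \<gamma>s, symmetric])
    also have "h (b x) (b y) P (\<gamma> y P s) = \<gamma> x P (g (a x) (a y) P s)"
      by (rule \<gamma>[OF x y P(1,3) s])
    finally show ?thesis .
  qed
  show ?thesis
    unfolding aut_cohomologous_def prod.case
    by (rule exI[of _ "\<lambda>y. w y \<inter> v y"], rule exI[of _ a], rule exI[of _ c], rule exI[of _ ?\<epsilon>],
      intro ballI conjI) (simp_all add: w v aut eq le_infI1 le_infI2 openin_Int)
qed

definition aut_subsheaf ::
    "('a, 's) superspace \<Rightarrow> ('a set \<Rightarrow> ('a, 's) sheaf_aut set) \<Rightarrow> bool" where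
  "aut_subsheaf S C \<longleftrightarrow>
     (\<forall>W. \<forall>\<alpha>\<in>C W. \<alpha> \<in> sheaf_auts S W \<and> local_aut S W \<alpha> \<and>
        (\<forall>W'\<subseteq>W. restrict \<alpha> (opens_in S W') \<in> C W'))"

lemma aut_gsheaf_simps [simp]:
  "carrier (gs_grp (aut_gsheaf S C) W) = C W"
  "\<alpha> \<otimes>\<^bsub>gs_grp (aut_gsheaf S C) W\<^esub> \<beta> =
     (\<lambda>V\<in>opens_in S W. compose (carrier (sp_alg S V)) (\<alpha> V) (\<beta> V))"
  "\<one>\<^bsub>gs_grp (aut_gsheaf S C) W\<^esub> = (\<lambda>V\<in>opens_in S W. \<lambda>s\<in>carrier (sp_alg S V). s)"
  "gs_res (aut_gsheaf S C) U W \<alpha> = restrict \<alpha> (opens_in S W)"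
  by (simp_all add: aut_gsheaf_def sheaf_aut_group_def)

lemma sheaf_auts_extensional:
  assumes "\<alpha> \<in> sheaf_auts S W"
  shows "\<alpha> \<in> extensional (opens_in S W)"
    and "V \<in> opens_in S W \<Longrightarrow> \<alpha> V \<in> extensional (carrier (sp_alg S V))"
  using assms by (auto simp: sheaf_auts_def)

lemma aut_cocycleI:
  assumes C: "aut_subsheaf S C" and g: "(\<U>, g) \<in> cocycles (sp_top S) (aut_gsheaf S C)"
  shows "aut_cocycle S \<U> g"
  unfolding aut_cocycle_def
proof (intro conjI ballI)
  show "openin (sp_top S) U" if "U \<in> \<U>" for U
    using g that by (auto simp: cocycles_def)
  show "local_aut S (U \<inter> V) (g U V)" if "U \<in> \<U>" "V \<in> \<U>" for U V
    using g that C by (auto simp: cocycles_def aut_subsheaf_def)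
  fix U V W P s
  assume U: "U \<in> \<U>" "V \<in> \<U>" "W \<in> \<U>" and P: "P \<in> opens_in S (U \<inter> V \<inter> W)"
    and s: "s \<in> carrier (sp_alg S P)"
  from g U have "(\<lambda>Q\<in>opens_in S (U \<inter> V \<inter> W). compose (carrier (sp_alg S Q))
      (restrict (g U V) (opens_in S (U \<inter> V \<inter> W)) Q) (restrict (g V W) (opens_in S (U \<inter> V \<inter> W)) Q))
    = restrict (g U W) (opens_in S (U \<inter> V \<inter> W))"
    by (auto simp: cocycles_def)
  from fun_cong[OF fun_cong[OF this, of P], of s] show "g U V P (g V W P s) = g U W P s"
    using P s by (simp add: compose_def)
qed

lemma aut_restrict_diag:
  assumes C: "aut_subsheaf S C" and g: "(\<U>, g) \<in> cocycles (sp_top S) (aut_gsheaf S C)"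
    and U: "U \<in> \<U>" "W \<subseteq> U"
  shows "restrict (g U U) (opens_in S W) = \<one>\<^bsub>gs_grp (aut_gsheaf S C) W\<^esub>"
    and "\<one>\<^bsub>gs_grp (aut_gsheaf S C) W\<^esub> \<in> C W"
proof -
  have gU: "g U U \<in> C U"
    using g U by (force simp: cocycles_def)
  show *: "restrict (g U U) (opens_in S W) = \<one>\<^bsub>gs_grp (aut_gsheaf S C) W\<^esub>"
  proof (intro ext)
    fix V s
    show "restrict (g U U) (opens_in S W) V s = \<one>\<^bsub>gs_grp (aut_gsheaf S C) W\<^esub> V s"
    proof (cases "V \<in> opens_in S W")
      case True
      then have V: "V \<in> opens_in S U" using U(2) by (rule opens_in_trans)
      have "g U U V \<in> extensional (carrier (sp_alg S V))"
        using gU C V sheaf_auts_extensional(2) unfolding aut_subsheaf_def by blast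
      then show ?thesis
        using True aut_cocycle_diag[OF aut_cocycleI[OF C g] U(1) V]
        by (cases "s \<in> carrier (sp_alg S V)") (auto simp: extensional_def)
    qed simp
  qed
  show "\<one>\<^bsub>gs_grp (aut_gsheaf S C) W\<^esub> \<in> C W"
    using gU C U(2) *[symmetric] unfolding aut_subsheaf_def by metis
qed

text \<open>The subsheaf is not assumed to contain the identities; the diagonal of the cocycle supplies them.\<close>

lemma cohomology_rel_refl:
  assumes C: "aut_subsheaf S C" and c: "c \<in> cocycles (sp_top S) (aut_gsheaf S C)"
  shows "(c, c) \<in> cohomology_rel (sp_top S) (aut_gsheaf S C)"
proof -
  obtain \<U> g where cg: "c = (\<U>, g)" by (cases c)
  note g = c[unfolded cg]
  let ?F = "aut_gsheaf S C"
  have eq: "gs_res ?F (U \<inter> V) (U \<inter> V) (g U V) =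
      gs_res ?F U (U \<inter> V) (g U U) \<otimes>\<^bsub>gs_grp ?F (U \<inter> V)\<^esub>
      gs_res ?F (U \<inter> V) (U \<inter> V) (g U V) \<otimes>\<^bsub>gs_grp ?F (U \<inter> V)\<^esub>
      inv\<^bsub>gs_grp ?F (U \<inter> V)\<^esub> (gs_res ?F V (U \<inter> V) (g V V))"
    if U: "U \<in> \<U>" "V \<in> \<U>" for U V
  proof -
    let ?G = "gs_grp ?F (U \<inter> V)"
    have one: "gs_res ?F V (U \<inter> V) (g V V) = \<one>\<^bsub>?G\<^esub>" "gs_res ?F U (U \<inter> V) (g U U) = \<one>\<^bsub>?G\<^esub>" "\<one>\<^bsub>?G\<^esub> \<in> C (U \<inter> V)"
      using aut_restrict_diag[OF C g] U by simp_all
    have unit: "\<alpha> \<otimes>\<^bsub>?G\<^esub> \<one>\<^bsub>?G\<^esub> = \<alpha> \<and> \<one>\<^bsub>?G\<^esub> \<otimes>\<^bsub>?G\<^esub> \<alpha> = \<alpha>" if "\<alpha> \<in> C (U \<inter> V)" for \<alpha>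
    proof -
      have \<alpha>: "\<alpha> \<in> sheaf_auts S (U \<inter> V)" and l: "local_aut S (U \<inter> V) \<alpha>"
        using that C unfolding aut_subsheaf_def by blast+
      have "(\<alpha> \<otimes>\<^bsub>?G\<^esub> \<one>\<^bsub>?G\<^esub>) P s = \<alpha> P s \<and> (\<one>\<^bsub>?G\<^esub> \<otimes>\<^bsub>?G\<^esub> \<alpha>) P s = \<alpha> P s" for P s
      proof (cases "P \<in> opens_in S (U \<inter> V)")
        case True
        then have e: "\<alpha> P \<in> extensional (carrier (sp_alg S P))"
          using sheaf_auts_extensional(2)[OF \<alpha>] by blast
        show ?thesis
          using True e local_aut_carrier[OF l True]
          by (cases "s \<in> carrier (sp_alg S P)") (auto simp: compose_def extensional_def)
      next
        case False
        then show ?thesis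
          using sheaf_auts_extensional(1)[OF \<alpha>] by (simp add: extensional_def)
      qed
      then show ?thesis by blast
    qed
    have "inv\<^bsub>?G\<^esub> \<one>\<^bsub>?G\<^esub> = \<one>\<^bsub>?G\<^esub>"
      unfolding m_inv_def
    proof (rule the_equality)
      show "\<one>\<^bsub>?G\<^esub> \<in> carrier ?G \<and> \<one>\<^bsub>?G\<^esub> \<otimes>\<^bsub>?G\<^esub> \<one>\<^bsub>?G\<^esub> = \<one>\<^bsub>?G\<^esub> \<and> \<one>\<^bsub>?G\<^esub> \<otimes>\<^bsub>?G\<^esub> \<one>\<^bsub>?G\<^esub> = \<one>\<^bsub>?G\<^esub>"
        using unit[OF one(3)] one(3) by (metis aut_gsheaf_simps(1))
      show "\<alpha> = \<one>\<^bsub>?G\<^esub>" if "\<alpha> \<in> carrier ?G \<and> \<one>\<^bsub>?G\<^esub> \<otimes>\<^bsub>?G\<^esub> \<alpha> = \<one>\<^bsub>?G\<^esub> \<and> \<alpha> \<otimes>\<^bsub>?G\<^esub> \<one>\<^bsub>?G\<^esub> = \<one>\<^bsub>?G\<^esub>" for \<alpha>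
        using that unit[of \<alpha>] by (metis aut_gsheaf_simps(1))
    qed
    moreover have "gs_res ?F (U \<inter> V) (U \<inter> V) (g U V) \<in> C (U \<inter> V)"
    proof -
      have "g U V \<in> C (U \<inter> V)"
        using g U by (auto simp: cocycles_def)
      then show ?thesis
        using C unfolding aut_subsheaf_def by auto
    qed
    ultimately show ?thesis
      using unit one by metis
  qed
  have "\<forall>U\<in>\<U>. openin (sp_top S) U" "\<Union> \<U> = topspace (sp_top S)" "\<forall>U\<in>\<U>. g U U \<in> carrier (gs_grp ?F U)"
    using g by (force simp: cocycles_def)+
  then show ?thesis
    using g eq unfolding cg cohomology_rel_def mem_Collect_eq prod.case
    by (intro conjI exI[of _ \<U>] exI[of _ "\<lambda>W. W"] exI[of _ "\<lambda>W. g W W"]) blast+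
qed

lemma bij_betw_eq_except_one:
  assumes f: "bij_betw f A B" and g: "bij_betw g A B"
    and eq: "\<And>x. x \<in> A \<Longrightarrow> x \<noteq> a \<Longrightarrow> f x = g x" and a: "a \<in> A"
  shows "f a = g a"
proof -
  obtain x where x: "x \<in> A" "g x = f a"
    using f g a by (metis bij_betwE bij_betw_iff_bijections)
  have "x = a"
    using x eq[of x] f a by (metis bij_betw_def inj_on_eq_iff)
  then show ?thesis using x by simp
qed

text \<open>The sections of a subsheaf of automorphisms need not be known to form groups. If \<open>\<gamma>\<close>
  has no inverse over \<open>W\<close>, then it has none over any larger set, and all these inverses are the same
  junk value. The relation on the diagonal then forces that value to invert \<open>\<gamma>\<close>
  at all sections but at most one, namely \<open>undefined\<close>.\<close>

lemma aut_cohomologous_cohomology_rel: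
  assumes C: "aut_subsheaf S C"
    and rel: "(c, d) \<in> cohomology_rel (sp_top S) (aut_gsheaf S C)"
  shows "aut_cohomologous S c d"
proof -
  let ?F = "aut_gsheaf S C"
  obtain \<U> g \<V> h where cd: "c = (\<U>, g)" "d = (\<V>, h)" by (cases c, cases d)
  from rel obtain \<W> \<sigma> \<tau> \<gamma> where
    g: "(\<U>, g) \<in> cocycles (sp_top S) ?F" and h: "(\<V>, h) \<in> cocycles (sp_top S) ?F"
    and W_open: "\<And>W. W \<in> \<W> \<Longrightarrow> openin (sp_top S) W" and W_cover: "\<Union> \<W> = topspace (sp_top S)"
    and W: "\<And>W. W \<in> \<W> \<Longrightarrow> \<sigma> W \<in> \<U> \<and> W \<subseteq> \<sigma> W \<and> \<tau> W \<in> \<V> \<and> W \<subseteq> \<tau> W \<and> \<gamma> W \<in> C W"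
    and eq: "\<And>W W'. W \<in> \<W> \<Longrightarrow> W' \<in> \<W> \<Longrightarrow>
      gs_res ?F (\<tau> W \<inter> \<tau> W') (W \<inter> W') (h (\<tau> W) (\<tau> W')) =
        gs_res ?F W (W \<inter> W') (\<gamma> W) \<otimes>\<^bsub>gs_grp ?F (W \<inter> W')\<^esub>
        gs_res ?F (\<sigma> W \<inter> \<sigma> W') (W \<inter> W') (g (\<sigma> W) (\<sigma> W')) \<otimes>\<^bsub>gs_grp ?F (W \<inter> W')\<^esub>
        inv\<^bsub>gs_grp ?F (W \<inter> W')\<^esub> (gs_res ?F W' (W \<inter> W') (\<gamma> W'))"
    unfolding cd cohomology_rel_def mem_Collect_eq prod.case by (metis aut_gsheaf_simps(1))
  note gc = aut_cocycleI[OF C g] and hc = aut_cocycleI[OF C h]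
  have l\<gamma>: "local_aut S W (\<gamma> W)" if "W \<in> \<W>" for W
    using W[OF that] C unfolding aut_subsheaf_def by blast
  have lg: "local_aut S (W \<inter> W') (g (\<sigma> W) (\<sigma> W'))" if "W \<in> \<W>" "W' \<in> \<W>" for W W'
    using gc W[OF that(1)] W[OF that(2)] unfolding aut_cocycle_def
    by (meson Int_mono local_aut_mono)
  have lh: "local_aut S (W \<inter> W') (h (\<tau> W) (\<tau> W'))" if "W \<in> \<W>" "W' \<in> \<W>" for W W'
    using hc W[OF that(1)] W[OF that(2)] unfolding aut_cocycle_def
    by (meson Int_mono local_aut_mono)
  have ev: "h (\<tau> W) (\<tau> W') P s =
      (let t = (inv\<^bsub>gs_grp ?F (W \<inter> W')\<^esub> (restrict (\<gamma> W') (opens_in S (W \<inter> W')))) P s in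
       if t \<in> carrier (sp_alg S P) then \<gamma> W P (g (\<sigma> W) (\<sigma> W') P t) else undefined)"
    if "W \<in> \<W>" "W' \<in> \<W>" "P \<in> opens_in S (W \<inter> W')" "s \<in> carrier (sp_alg S P)" for W W' P s
    using fun_cong[OF fun_cong[OF eq[OF that(1,2)], of P], of s] that(3,4)
    by (simp add: compose_def Let_def)
  have main: "h (\<tau> W) (\<tau> W') P (\<gamma> W' P s) = \<gamma> W P (g (\<sigma> W) (\<sigma> W') P s)"
    if WW': "W \<in> \<W>" "W' \<in> \<W>" and P: "P \<in> opens_in S (W \<inter> W')" and s: "s \<in> carrier (sp_alg S P)"
    for W W' P s
  proof -
    let ?O = "W \<inter> W'" let ?A = "carrier (sp_alg S P)"
    let ?\<alpha> = "restrict (\<gamma> W') (opens_in S ?O)"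
    let ?inv = "\<lambda>Q \<alpha> \<beta>. \<beta> \<in> carrier (gs_grp ?F Q) \<and> \<alpha> \<otimes>\<^bsub>gs_grp ?F Q\<^esub> \<beta> = \<one>\<^bsub>gs_grp ?F Q\<^esub> \<and>
      \<beta> \<otimes>\<^bsub>gs_grp ?F Q\<^esub> \<alpha> = \<one>\<^bsub>gs_grp ?F Q\<^esub>"
    have PW: "P \<in> opens_in S W" "P \<in> opens_in S W'"
      using P by (auto simp: opens_in_Int)
    have \<gamma>in: "\<gamma> W' P t \<in> ?A" if "t \<in> ?A" for t
      using local_aut_carrier[OF l\<gamma>[OF WW'(2)] PW(2)] that .
    have inverse: "\<beta> P (\<gamma> W' P t) = t" if "?inv ?O ?\<alpha> \<beta>" "t \<in> ?A" for \<beta> t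
    proof -
      have "(\<beta> \<otimes>\<^bsub>gs_grp ?F ?O\<^esub> ?\<alpha>) P t = \<one>\<^bsub>gs_grp ?F ?O\<^esub> P t"
        using that by simp
      then show ?thesis
        using P that(2) by (simp add: compose_def)
    qed
    have claim: ?thesis
      if "(inv\<^bsub>gs_grp ?F ?O\<^esub> ?\<alpha>) P (\<gamma> W' P s) = s"
      using ev[OF WW' P \<gamma>in[OF s]] that s by simp
    show ?thesis
    proof (cases "\<exists>\<beta>. ?inv ?O ?\<alpha> \<beta>")
      case True
      then obtain \<beta> where \<beta>: "?inv ?O ?\<alpha> \<beta>" by blast
      have "\<beta>' = \<beta>" if \<beta>': "?inv ?O ?\<alpha> \<beta>'" for \<beta>'
      proof (intro ext)
        fix Q t
        have CC: "\<beta> \<in> sheaf_auts S ?O" "\<beta>' \<in> sheaf_auts S ?O" "local_aut S ?O \<beta>"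
          using \<beta> \<beta>' C unfolding aut_subsheaf_def by auto
        show "\<beta>' Q t = \<beta> Q t"
        proof (cases "Q \<in> opens_in S ?O \<and> t \<in> carrier (sp_alg S Q)")
          case True
          then have Q: "Q \<in> opens_in S ?O" and t: "t \<in> carrier (sp_alg S Q)" by auto
          have b: "\<beta> Q t \<in> carrier (sp_alg S Q)"
            using local_aut_carrier[OF CC(3) Q t] .
          have "(?\<alpha> \<otimes>\<^bsub>gs_grp ?F ?O\<^esub> \<beta>) Q t = \<one>\<^bsub>gs_grp ?F ?O\<^esub> Q t"
            using \<beta> by simp
          then have 1: "\<gamma> W' Q (\<beta> Q t) = t"
            using Q t by (simp add: compose_def)
          have "(\<beta>' \<otimes>\<^bsub>gs_grp ?F ?O\<^esub> ?\<alpha>) Q (\<beta> Q t) = \<one>\<^bsub>gs_grp ?F ?O\<^esub> Q (\<beta> Q t)"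
            using \<beta>' by simp
          then show ?thesis
            using Q b 1 by (simp add: compose_def)
        next
          case False
          then show ?thesis
            using sheaf_auts_extensional[OF CC(1)] sheaf_auts_extensional[OF CC(2)]
            by (cases "Q \<in> opens_in S ?O") (auto simp: extensional_def)
        qed
      qed
      then have "inv\<^bsub>gs_grp ?F ?O\<^esub> ?\<alpha> = \<beta>"
        unfolding m_inv_def using \<beta> by (intro the_equality)
      then show ?thesis
        using claim inverse[OF \<beta> s] by simp
    next
      case False
      have "\<not> ?inv W' (\<gamma> W') \<beta>" for \<beta>
      proof
        assume \<beta>: "?inv W' (\<gamma> W') \<beta>"
        have "?inv ?O ?\<alpha> (restrict \<beta> (opens_in S ?O))"
        proof (intro conjI)
          show "restrict \<beta> (opens_in S ?O) \<in> carrier (gs_grp ?F ?O)"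
            using \<beta> C unfolding aut_subsheaf_def by auto
          have sub: "Q \<in> opens_in S W'" if "Q \<in> opens_in S ?O" for Q
            using that by (auto simp: opens_in_Int)
          have 1: "compose (carrier (sp_alg S Q)) (\<gamma> W' Q) (\<beta> Q) = (\<lambda>s\<in>carrier (sp_alg S Q). s)"
            if "Q \<in> opens_in S ?O" for Q
            using \<beta> sub[OF that] by (auto dest!: fun_cong[where x = Q])
          have 2: "compose (carrier (sp_alg S Q)) (\<beta> Q) (\<gamma> W' Q) = (\<lambda>s\<in>carrier (sp_alg S Q). s)"
            if "Q \<in> opens_in S ?O" for Q
            using \<beta> sub[OF that] by (auto dest!: fun_cong[where x = Q])
          show "?\<alpha> \<otimes>\<^bsub>gs_grp ?F ?O\<^esub> restrict \<beta> (opens_in S ?O) = \<one>\<^bsub>gs_grp ?F ?O\<^esub>"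
            using 1 by (auto intro!: restrict_ext)
          show "restrict \<beta> (opens_in S ?O) \<otimes>\<^bsub>gs_grp ?F ?O\<^esub> ?\<alpha> = \<one>\<^bsub>gs_grp ?F ?O\<^esub>"
            using 2 by (auto intro!: restrict_ext)
        qed
        with False show False by blast
      qed
      then have "?inv W' (\<gamma> W') = (\<lambda>\<beta>. False)" "?inv ?O ?\<alpha> = (\<lambda>\<beta>. False)"
        using False by blast+
      then have junk: "inv\<^bsub>gs_grp ?F ?O\<^esub> ?\<alpha> = inv\<^bsub>gs_grp ?F W'\<^esub> (\<gamma> W')"
        unfolding m_inv_def by presburger
      define u where "u = (inv\<^bsub>gs_grp ?F W'\<^esub> (\<gamma> W')) P"
      have \<gamma>W': "restrict (\<gamma> W') (opens_in S W') = \<gamma> W'"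
        using W[OF WW'(2)] C sheaf_auts_extensional(1) unfolding aut_subsheaf_def
        by (meson extensional_restrict)
      have diag: "t = (if u t \<in> ?A then \<gamma> W' P (u t) else undefined)" if t: "t \<in> ?A" for t
      proof -
        have "h (\<tau> W') (\<tau> W') P t = t"
          using aut_cocycle_diag[OF hc _ _ t] W[OF WW'(2)] PW(2) opens_in_trans by blast
        moreover have "g (\<sigma> W') (\<sigma> W') P r = r" if "r \<in> ?A" for r
          using aut_cocycle_diag[OF gc _ _ that] W[OF WW'(2)] PW(2) opens_in_trans by blast
        ultimately show ?thesis
          using ev[OF WW'(2,2), of P t] PW(2) t \<gamma>W' by (auto simp: u_def Let_def)
      qed
      have good: "h (\<tau> W) (\<tau> W') P (\<gamma> W' P t) = \<gamma> W P (g (\<sigma> W) (\<sigma> W') P t)"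
        if t: "t \<in> ?A" and nu: "\<gamma> W' P t \<noteq> undefined" for t
      proof -
        have 1: "u (\<gamma> W' P t) \<in> ?A" and 2: "\<gamma> W' P (u (\<gamma> W' P t)) = \<gamma> W' P t"
          using diag[OF \<gamma>in[OF t]] nu by presburger+
        then have "u (\<gamma> W' P t) = t"
          using local_aut_inj[OF l\<gamma>[OF WW'(2)] PW(2)] t by blast
        then show ?thesis
          using ev[OF WW' P \<gamma>in[OF t]] t unfolding junk u_def[symmetric] by simp
      qed
      show ?thesis
      proof (cases "\<gamma> W' P s = undefined")
        case True
        have b: "bij_betw (\<gamma> W P) ?A ?A" "bij_betw (\<gamma> W' P) ?A ?A"
          "bij_betw (g (\<sigma> W) (\<sigma> W') P) ?A ?A" "bij_betw (h (\<tau> W) (\<tau> W') P) ?A ?A"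
          using l\<gamma> lg lh WW' P PW unfolding local_aut_def by blast+
        have "bij_betw (\<lambda>t. h (\<tau> W) (\<tau> W') P (\<gamma> W' P t)) ?A ?A"
          "bij_betw (\<lambda>t. \<gamma> W P (g (\<sigma> W) (\<sigma> W') P t)) ?A ?A"
          using bij_betw_trans[OF b(2,4)] bij_betw_trans[OF b(3,1)] by (simp_all add: comp_def)
        then show ?thesis
        proof (rule bij_betw_eq_except_one)
          fix t assume t: "t \<in> ?A" "t \<noteq> s"
          then have "\<gamma> W' P t \<noteq> undefined"
            using True local_aut_inj[OF l\<gamma>[OF WW'(2)] PW(2) t(1) s] by simp
          then show "h (\<tau> W) (\<tau> W') P (\<gamma> W' P t) = \<gamma> W P (g (\<sigma> W) (\<sigma> W') P t)"
            using good t by blast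
        qed (rule s)
      next
        case False
        then show ?thesis using good s by blast
      qed
    qed
  qed
  have "\<forall>y\<in>topspace (sp_top S). \<exists>W\<in>\<W>. y \<in> W"
    using W_cover by blast
  then obtain w where w: "\<And>y. y \<in> topspace (sp_top S) \<Longrightarrow> w y \<in> \<W> \<and> y \<in> w y"
    by metis
  have w\<W>: "w y \<in> \<W>" "y \<in> w y" "\<sigma> (w y) \<in> \<U>" "w y \<subseteq> \<sigma> (w y)" "\<tau> (w y) \<in> \<V>" "w y \<subseteq> \<tau> (w y)"
    if "y \<in> topspace (sp_top S)" for y
    using w[OF that] W[of "w y"] by auto
  show ?thesis
    unfolding cd aut_cohomologous_def prod.case
    by (intro exI[of _ w] exI[of _ "\<lambda>y. \<sigma> (w y)"] exI[of _ "\<lambda>y. \<tau> (w y)"] exI[of _ "\<lambda>y. \<gamma> (w y)"]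
      ballI conjI) (simp_all add: w\<W> W_open l\<gamma> main)
qed

lemma aut_cohomologous_refinement:
  assumes "\<And>V. V \<in> \<V> \<Longrightarrow> openin (sp_top S) V" "\<Union> \<V> = topspace (sp_top S)"
    and "\<And>V. V \<in> \<V> \<Longrightarrow> \<tau> V \<in> \<U> \<and> V \<subseteq> \<tau> V"
    and "\<And>V V'. V \<in> \<V> \<Longrightarrow> V' \<in> \<V> \<Longrightarrow> h V V' = restrict (g (\<tau> V) (\<tau> V')) (opens_in S (V \<inter> V'))"
  shows "aut_cohomologous S (\<U>, g) (\<V>, h)"
proof -
  have "\<forall>y\<in>topspace (sp_top S). \<exists>W\<in>\<V>. y \<in> W"
    using assms(2) by blast
  then obtain w where w: "\<And>y. y \<in> topspace (sp_top S) \<Longrightarrow> w y \<in> \<V> \<and> y \<in> w y"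
    by metis
  show ?thesis
    unfolding aut_cohomologous_def prod.case
    by (intro exI[of _ w] exI[of _ "\<lambda>y. \<tau> (w y)"] exI[of _ "\<lambda>y P s. s"])
      (use w assms local_aut_id in auto)
qed

section \<open>Sections of the exterior algebra\<close>

lemma holo_on_Cn_local:
  assumes A: "openin (top_of_set (Cn n)) A"
    and loc: "\<And>z. z \<in> A \<Longrightarrow> \<exists>B G. openin (top_of_set (Cn n)) B \<and> z \<in> B \<and> B \<subseteq> A \<and>
      holo_on_Cn n B G \<and> (\<forall>x\<in>B. F x = G x)"
  shows "holo_on_Cn n A F"
  unfolding holo_on_Cn_def
proof (intro conjI ballI allI impI)
  show "continuous_on A F"
    unfolding continuous_on_eq_continuous_within
  proof
    fix z assume z: "z \<in> A"
    then obtain B G where B: "openin (top_of_set (Cn n)) B" "z \<in> B" "B \<subseteq> A"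
      and G: "holo_on_Cn n B G" "\<forall>x\<in>B. F x = G x"
      using loc[OF z] by blast
    obtain T where T: "open T" "B = Cn n \<inter> T"
      using B(1) by (auto simp: openin_open)
    have "A \<subseteq> Cn n"
      using A openin_imp_subset by blast
    then have "at z within A = at z within B"
      using T B by (intro at_within_nhd[of _ T]) auto
    moreover have "continuous_on B F"
      using G by (simp add: holo_on_Cn_def cong: continuous_on_cong)
    ultimately show "continuous (at z within A) F"
      using B(2) by (simp add: continuous_on_eq_continuous_within)
  qed
next
  fix z k assume z: "z \<in> A" and k: "k < n"
  then obtain B G where B: "openin (top_of_set (Cn n)) B" "z \<in> B" "B \<subseteq> A"
    and G: "holo_on_Cn n B G" "\<forall>x\<in>B. F x = G x"
    using loc[OF z] by blast
  obtain T where T: "open T" "B = Cn n \<inter> T"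
    using B(1) by (auto simp: openin_open)
  let ?N = "{t. z(k := t) \<in> T}"
  have "continuous_on UNIV (\<lambda>t. z(k := t))"
  proof (rule continuous_on_coordinatewise_then_product)
    show "continuous_on UNIV (\<lambda>t. (z(k := t)) i)" for i
      by (cases "i = k") auto
  qed
  then have "open ?N"
    using T(1) by (auto simp: continuous_on_open_vimage vimage_def)
  moreover have "F (z(k := t)) = G (z(k := t))" if "t \<in> ?N" for t
  proof -
    have "z(k := t) \<in> Cn n"
      using B(2) T(2) k by (auto simp: Cn_def)
    then show ?thesis using that G T by auto
  qed
  moreover have "(\<lambda>t. G (z(k := t))) field_differentiable at (z k)"
    using G B(2) k by (auto simp: holo_on_Cn_def)
  moreover have "z k \<in> ?N"
    using B(2) T(2) by auto
  ultimately show "(\<lambda>t. F (z(k := t))) field_differentiable at (z k)"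
    unfolding field_differentiable_def
    by (metis (no_types, lifting) has_field_derivative_transform_within_open)
qed

lemma chart_on_image_Int:
  assumes "chart_on T n (U, \<phi>)" "openin T V"
  shows "openin (top_of_set (Cn n)) (\<phi> ` (U \<inter> V))"
proof -
  have U: "openin T U" "openin (top_of_set (Cn n)) (\<phi> ` U)"
    and h: "homeomorphic_map (subtopology T U) (top_of_set (\<phi> ` U)) \<phi>"
    using assms(1) by (auto simp: chart_on_def)
  have "openin (subtopology T U) (U \<inter> V)"
    using assms(2) by (auto simp: openin_subtopology)
  then have "openin (top_of_set (\<phi> ` U)) (\<phi> ` (U \<inter> V))"
    using h by (meson homeomorphic_imp_open_map open_map_def)
  then show ?thesis
    using U(2) openin_trans by blast
qed

lemma chart_on_inv_into:
  assumes "chart_on T n (U, \<phi>)" "x \<in> U"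
  shows "inv_into U \<phi> (\<phi> x) = x"
proof -
  have "openin T U" "homeomorphic_map (subtopology T U) (top_of_set (\<phi> ` U)) \<phi>"
    using assms(1) by (auto simp: chart_on_def)
  then have "inj_on \<phi> U"
    by (metis homeomorphic_imp_injective_map inf.absorb2 openin_subset topspace_subtopology)
  then show ?thesis
    using assms(2) by simp
qed

lemma complex_manifold_chart:
  "complex_manifold M \<Longrightarrow> c \<in> atlas M \<Longrightarrow> chart_on (mtop M) (mdim M) c"
  by (auto simp: complex_manifold_def)

lemma holo_fun_local:
  assumes M: "complex_manifold M" and W: "openin (mtop M) W"
    and loc: "\<And>y. y \<in> W \<Longrightarrow> \<exists>V f'. openin (mtop M) V \<and> y \<in> V \<and> V \<subseteq> W \<and> holo_fun M V f' \<and>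
      (\<forall>x\<in>V. f x = f' x)"
  shows "holo_fun M W f"
  unfolding holo_fun_def
proof clarify
  fix U \<phi> assume c: "(U, \<phi>) \<in> atlas M"
  note chart = complex_manifold_chart[OF M c]
  show "holo_on_Cn (mdim M) (\<phi> ` (U \<inter> W)) (\<lambda>z. f (inv_into U \<phi> z))"
  proof (rule holo_on_Cn_local)
    show "openin (top_of_set (Cn (mdim M))) (\<phi> ` (U \<inter> W))"
      using chart W by (rule chart_on_image_Int)
    fix z assume "z \<in> \<phi> ` (U \<inter> W)"
    then obtain y where y: "y \<in> U" "y \<in> W" "z = \<phi> y" by blast
    then obtain V f' where V: "openin (mtop M) V" "y \<in> V" "V \<subseteq> W" "holo_fun M V f'"
        "\<forall>x\<in>V. f x = f' x"
      using loc[OF y(2)] by blast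
    have "holo_on_Cn (mdim M) (\<phi> ` (U \<inter> V)) (\<lambda>z. f' (inv_into U \<phi> z))"
      using V(4) c by (auto simp: holo_fun_def)
    moreover have "\<forall>x\<in>\<phi> ` (U \<inter> V). f (inv_into U \<phi> x) = f' (inv_into U \<phi> x)"
      using V(5) chart_on_inv_into[OF chart] by auto
    ultimately show "\<exists>B G. openin (top_of_set (Cn (mdim M))) B \<and> z \<in> B \<and> B \<subseteq> \<phi> ` (U \<inter> W) \<and>
        holo_on_Cn (mdim M) B G \<and> (\<forall>x\<in>B. f (inv_into U \<phi> x) = G x)"
      using chart_on_image_Int[OF chart V(1)] V(2,3) y
      by (intro exI[of _ "\<phi> ` (U \<inter> V)"] exI[of _ "\<lambda>z. f' (inv_into U \<phi> z)"]) auto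
  qed
qed

lemma holo_fun_mono:
  assumes "holo_fun M W f" "W' \<subseteq> W"
  shows "holo_fun M W' f"
  using assms continuous_on_subset[OF _ image_mono[OF Int_mono[OF order_refl assms(2)]]]
  unfolding holo_fun_def holo_on_Cn_def by fast

lemma holo_fun_cmult:
  assumes "holo_fun M W f"
  shows "holo_fun M W (\<lambda>y. c * f y)"
  using assms unfolding holo_fun_def holo_on_Cn_def
  by (fast intro: continuous_on_mult_left field_differentiable_mult[OF field_differentiable_const])

lemma split_model_simps [simp]:
  "sp_top (split_model M E) = mtop M"
  "sp_alg (split_model M E) = ext_section_alg M E"
  "sp_res (split_model M E) U V s = restrict s V"
  by (simp_all add: split_model_def)

lemma ext_section_alg_simps [simp]:
  "carrier (ext_section_alg M E W) = ext_sections M E W"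
  "s \<otimes>\<^bsub>ext_section_alg M E W\<^esub> s' = (\<lambda>y\<in>W. wedge (s y) (s' y))"
  "\<one>\<^bsub>ext_section_alg M E W\<^esub> = (\<lambda>y\<in>W. form_one)"
  "s \<oplus>\<^bsub>ext_section_alg M E W\<^esub> s' = (\<lambda>y\<in>W. \<lambda>ls. s y ls + s' y ls)"
  "c \<odot>\<^bsub>ext_section_alg M E W\<^esub> s = (\<lambda>y\<in>W. \<lambda>ls. c * s y ls)"
  by (simp_all add: ext_section_alg_def)

lemma is_model_triv_open:
  assumes "is_model M E" "(U, t) \<in> vb_triv E"
  shows "openin (mtop M) U"
  using assms unfolding is_model_def holo_vbundle_def by blast

lemma ext_sections_local:
  assumes E: "is_model M E" and W: "openin (mtop M) W" and s: "s \<in> extensional W"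
    and loc: "\<And>y. y \<in> W \<Longrightarrow>
      \<exists>V s'. openin (mtop M) V \<and> y \<in> V \<and> V \<subseteq> W \<and> s' \<in> ext_sections M E V \<and> (\<forall>x\<in>V. s x = s' x)"
  shows "s \<in> ext_sections M E W"
  unfolding ext_sections_def mem_Collect_eq
proof (intro conjI ballI)
  show "s y \<in> ext_alg E y" if "y \<in> W" for y
    using loc[OF that] by (auto simp: ext_sections_def)
  fix c assume c: "c \<in> vb_triv E"
  obtain U t where ct: "c = (U, t)" by (cases c)
  have U: "openin (mtop M) U"
    by (rule is_model_triv_open[OF E c[unfolded ct]])
  have "holo_fun M (U \<inter> W) (\<lambda>y. s y (map (coord E t y) is))" if "is": "set is \<subseteq> {..<vb_rank E}" for "is"
  proof (rule holo_fun_local)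
    show "complex_manifold M" "openin (mtop M) (U \<inter> W)"
      using E U W by (auto simp: is_model_def)
    fix y assume y: "y \<in> U \<inter> W"
    then have "y \<in> W" by blast
    from loc[OF this] obtain V s' where V: "openin (mtop M) V" "y \<in> V" "V \<subseteq> W" "s' \<in> ext_sections M E V"
        "\<forall>x\<in>V. s x = s' x"
      by blast
    have "holo_fun M (U \<inter> V) (\<lambda>y. s' y (map (coord E t y) is))"
      using V(4) c "is" unfolding ct ext_sections_def by blast
    then show "\<exists>V f'. openin (mtop M) V \<and> y \<in> V \<and> V \<subseteq> U \<inter> W \<and> holo_fun M V f' \<and>
        (\<forall>x\<in>V. s x (map (coord E t x) is) = f' x)"
      using V U y by (intro exI[of _ "U \<inter> V"] exI[of _ "\<lambda>y. s' y (map (coord E t y) is)"]) auto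
  qed
  then show "case c of (U, t) \<Rightarrow> \<forall>is. set is \<subseteq> {..<vb_rank E} \<longrightarrow>
      holo_fun M (U \<inter> W) (\<lambda>y. s y (map (coord E t y) is))"
    by (simp add: ct)
qed (rule s)

lemma ext_sections_extensional: "s \<in> ext_sections M E W \<Longrightarrow> s \<in> extensional W"
  by (simp add: ext_sections_def)

lemma ext_sections_restrict:
  assumes E: "is_model M E" and W': "openin (mtop M) W'" "W' \<subseteq> W" and s: "s \<in> ext_sections M E W"
  shows "restrict s W' \<in> ext_sections M E W'"
  unfolding ext_sections_def mem_Collect_eq
proof (intro conjI ballI)
  show "restrict s W' y \<in> ext_alg E y" if "y \<in> W'" for y
    using s that W' by (auto simp: ext_sections_def)
  fix c assume c: "c \<in> vb_triv E"
  obtain U t where ct: "c = (U, t)" by (cases c)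
  have U: "openin (mtop M) (U \<inter> W')"
    using is_model_triv_open[OF E c[unfolded ct]] W'(1) by (rule openin_Int)
  have "holo_fun M (U \<inter> W') (\<lambda>y. restrict s W' y (map (coord E t y) is))"
    if "is": "set is \<subseteq> {..<vb_rank E}" for "is"
  proof (rule holo_fun_local)
    show "complex_manifold M" "openin (mtop M) (U \<inter> W')"
      using E U by (auto simp: is_model_def)
    have "holo_fun M (U \<inter> W) (\<lambda>y. s y (map (coord E t y) is))"
      using s c "is" unfolding ct ext_sections_def by blast
    then have "holo_fun M (U \<inter> W') (\<lambda>y. s y (map (coord E t y) is))"
      by (rule holo_fun_mono) (use W' in blast)
    then show "\<exists>V f'. openin (mtop M) V \<and> y \<in> V \<and> V \<subseteq> U \<inter> W' \<and> holo_fun M V f' \<and>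
        (\<forall>x\<in>V. restrict s W' x (map (coord E t x) is) = f' x)" if "y \<in> U \<inter> W'" for y
      using U that by (intro exI[of _ "U \<inter> W'"] exI[of _ "\<lambda>y. s y (map (coord E t y) is)"] conjI ballI) simp_all
  qed
  then show "case c of (U, t) \<Rightarrow> \<forall>is. set is \<subseteq> {..<vb_rank E} \<longrightarrow>
      holo_fun M (U \<inter> W') (\<lambda>y. restrict s W' y (map (coord E t y) is))"
    by (simp add: ct)
qed simp

lemma ext_alg_cmult: "\<omega> \<in> ext_alg E y \<Longrightarrow> (\<lambda>ls. c * \<omega> ls) \<in> ext_alg E y"
  unfolding ext_alg_def by (auto simp: algebra_simps)

lemma ext_sections_cmult:
  assumes E: "is_model M E" and W: "openin (mtop M) W" and s: "s \<in> ext_sections M E W"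
  shows "(\<lambda>y\<in>W. \<lambda>ls. c * s y ls) \<in> ext_sections M E W"
  unfolding ext_sections_def mem_Collect_eq
proof (intro conjI ballI)
  show "(\<lambda>y\<in>W. \<lambda>ls. c * s y ls) y \<in> ext_alg E y" if "y \<in> W" for y
    using s that by (auto simp: ext_sections_def intro: ext_alg_cmult)
  fix d assume d: "d \<in> vb_triv E"
  obtain U t where dt: "d = (U, t)" by (cases d)
  have U: "openin (mtop M) (U \<inter> W)"
    using is_model_triv_open[OF E d[unfolded dt]] W by (rule openin_Int)
  have "holo_fun M (U \<inter> W) (\<lambda>y. (\<lambda>y\<in>W. \<lambda>ls. c * s y ls) y (map (coord E t y) is))"
    if "is": "set is \<subseteq> {..<vb_rank E}" for "is"
  proof (rule holo_fun_local)
    show "complex_manifold M" "openin (mtop M) (U \<inter> W)"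
      using E U by (auto simp: is_model_def)
    have "holo_fun M (U \<inter> W) (\<lambda>y. s y (map (coord E t y) is))"
      using s d "is" unfolding dt ext_sections_def by blast
    then have "holo_fun M (U \<inter> W) (\<lambda>y. c * s y (map (coord E t y) is))"
      by (rule holo_fun_cmult)
    then show "\<exists>V f'. openin (mtop M) V \<and> y \<in> V \<and> V \<subseteq> U \<inter> W \<and> holo_fun M V f' \<and>
        (\<forall>x\<in>V. (\<lambda>y\<in>W. \<lambda>ls. c * s y ls) x (map (coord E t x) is) = f' x)" if "y \<in> U \<inter> W" for y
      using U that by (intro exI[of _ "U \<inter> W"] exI[of _ "\<lambda>y. c * s y (map (coord E t y) is)"] conjI ballI) simp_all
  qed
  then show "case d of (U, t) \<Rightarrow> \<forall>is. set is \<subseteq> {..<vb_rank E} \<longrightarrow>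
      holo_fun M (U \<inter> W) (\<lambda>y. (\<lambda>y\<in>W. \<lambda>ls. c * s y ls) y (map (coord E t y) is))"
    by (simp add: dt)
qed simp

lemma wedge_cmult_left: "wedge (\<lambda>ls. c * \<omega> ls) \<eta> = (\<lambda>ls. c * wedge \<omega> \<eta> ls)"
  by (rule ext) (simp add: wedge_def sum_distrib_left mult_ac)

text \<open>That sections are closed under products is not available here. If the product of \<open>s\<close> and \<open>s'\<close> were no
  section, then \<open>\<alpha>\<close> would map both it and its double to the junk value \<open>undefined\<close>; but
  multiplicativity makes these images \<open>1\<close> and \<open>2\<close>.\<close>

lemma sheaf_auts_reflect_one:
  assumes E: "is_model M E" and \<alpha>: "\<alpha> \<in> sheaf_auts (split_model M E) W"
    and V: "V \<in> opens_in (split_model M E) W"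
    and s: "s \<in> ext_sections M E V" "s' \<in> ext_sections M E V"
    and one: "\<alpha> V s \<otimes>\<^bsub>ext_section_alg M E V\<^esub> \<alpha> V s' = \<one>\<^bsub>ext_section_alg M E V\<^esub>"
  shows "s \<otimes>\<^bsub>ext_section_alg M E V\<^esub> s' = \<one>\<^bsub>ext_section_alg M E V\<^esub>"
proof -
  let ?A = "ext_section_alg M E V"
  have V': "openin (mtop M) V"
    using V by (simp add: opens_in_def)
  have e: "\<alpha> V \<in> extensional (ext_sections M E V)"
    and b: "bij_betw (\<alpha> V) (ext_sections M E V) (ext_sections M E V)"
    and h: "superalg_hom (split_model M E) V (split_model M E) V (\<alpha> V)"
    using \<alpha> V by (auto simp: sheaf_auts_def)
  have mult: "\<alpha> V (r \<otimes>\<^bsub>?A\<^esub> r') = \<alpha> V r \<otimes>\<^bsub>?A\<^esub> \<alpha> V r'"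
    if "r \<in> ext_sections M E V" "r' \<in> ext_sections M E V" for r r'
    using h that ring_hom_mult[of "\<alpha> V" ?A ?A r r'] by (simp add: superalg_hom_def)
  have \<alpha>1: "\<alpha> V \<one>\<^bsub>?A\<^esub> = \<one>\<^bsub>?A\<^esub>"
    using h ring_hom_one[of "\<alpha> V" ?A ?A] by (simp add: superalg_hom_def)
  show ?thesis
  proof (cases "s \<otimes>\<^bsub>?A\<^esub> s' \<in> ext_sections M E V")
    case True
    have "\<alpha> V (s \<otimes>\<^bsub>?A\<^esub> s') = \<one>\<^bsub>?A\<^esub>"
      using mult[OF s] one by simp
    moreover from this have "\<one>\<^bsub>?A\<^esub> \<in> ext_sections M E V"
      using b True by (metis bij_betwE)
    ultimately show ?thesis
      using b True \<alpha>1 by (metis bij_betw_def inj_on_eq_iff)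
  next
    case False
    define s2 where "s2 = 2 \<odot>\<^bsub>?A\<^esub> s"
    have s2: "s2 \<in> ext_sections M E V"
      unfolding s2_def using ext_sections_cmult[OF E V' s(1), of 2] by simp
    have prod2: "s2 \<otimes>\<^bsub>?A\<^esub> s' = 2 \<odot>\<^bsub>?A\<^esub> (s \<otimes>\<^bsub>?A\<^esub> s')"
      by (auto simp: s2_def wedge_cmult_left)
    have "s2 \<otimes>\<^bsub>?A\<^esub> s' \<notin> ext_sections M E V"
    proof
      assume "s2 \<otimes>\<^bsub>?A\<^esub> s' \<in> ext_sections M E V"
      from ext_sections_cmult[OF E V' this, of "1/2"]
      have "(1/2) \<odot>\<^bsub>?A\<^esub> (2 \<odot>\<^bsub>?A\<^esub> (s \<otimes>\<^bsub>?A\<^esub> s')) \<in> ext_sections M E V"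
        unfolding prod2 by simp
      also have "(1/2) \<odot>\<^bsub>?A\<^esub> (2 \<odot>\<^bsub>?A\<^esub> (s \<otimes>\<^bsub>?A\<^esub> s')) = s \<otimes>\<^bsub>?A\<^esub> s'"
        by auto
      finally show False using False by blast
    qed
    then have "\<alpha> V s2 \<otimes>\<^bsub>?A\<^esub> \<alpha> V s' = undefined"
      using mult[OF s2 s(2)] e by (simp add: extensional_def)
    moreover have "\<one>\<^bsub>?A\<^esub> = undefined"
      using False mult[OF s] e one by (simp add: extensional_def)
    moreover have "\<alpha> V s2 = 2 \<odot>\<^bsub>?A\<^esub> \<alpha> V s"
      using h s(1) unfolding s2_def superalg_hom_def by simp
    ultimately have "(2 \<odot>\<^bsub>?A\<^esub> \<alpha> V s) \<otimes>\<^bsub>?A\<^esub> \<alpha> V s' = \<one>\<^bsub>?A\<^esub>"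
      by metis
    moreover have "(2 \<odot>\<^bsub>?A\<^esub> \<alpha> V s) \<otimes>\<^bsub>?A\<^esub> \<alpha> V s' = 2 \<odot>\<^bsub>?A\<^esub> (\<alpha> V s \<otimes>\<^bsub>?A\<^esub> \<alpha> V s')"
      by (auto simp: wedge_cmult_left)
    ultimately have two: "2 \<odot>\<^bsub>?A\<^esub> \<one>\<^bsub>?A\<^esub> = \<one>\<^bsub>?A\<^esub>"
      using one by metis
    have "V = {}"
    proof (rule ccontr)
      assume "V \<noteq> {}"
      then obtain y where "y \<in> V" by blast
      with fun_cong[OF fun_cong[OF two, of y], of "[]"] show False
        by (simp add: form_one_def)
    qed
    then show ?thesis by (simp add: restrict_def)
  qed
qed

lemma local_aut_sheaf_auts:
  assumes "is_model M E" "\<alpha> \<in> sheaf_auts (split_model M E) W"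
  shows "local_aut (split_model M E) W \<alpha>"
  unfolding local_aut_def
proof (intro conjI ballI impI)
  show "s \<otimes>\<^bsub>sp_alg (split_model M E) V\<^esub> s' = \<one>\<^bsub>sp_alg (split_model M E) V\<^esub>"
    if "V \<in> opens_in (split_model M E) W" "s \<in> carrier (sp_alg (split_model M E) V)"
      "s' \<in> carrier (sp_alg (split_model M E) V)"
      "\<alpha> V s \<otimes>\<^bsub>sp_alg (split_model M E) V\<^esub> \<alpha> V s' = \<one>\<^bsub>sp_alg (split_model M E) V\<^esub>" for V s s'
    using sheaf_auts_reflect_one[OF assms that(1), of s s'] that(2-)
    unfolding split_model_simps ext_section_alg_simps(1) by blast
qed (use assms(2) in \<open>auto simp: sheaf_auts_def\<close>)

section \<open>Gluing along a trivialised cocycle\<close>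

locale trivialised_cocycle =
  fixes M :: "'a cmfd" and E :: "('a, 'e) vbundle"
    and \<U> :: "'a set set" and g :: "'a set \<Rightarrow> 'a set \<Rightarrow> ('a, ('a, 'e) fsection) sheaf_aut"
    and w u :: "'a \<Rightarrow> 'a set" and c :: "'a \<Rightarrow> ('a, ('a, 'e) fsection) sheaf_aut"
  assumes model: "is_model M E"
    and cocycle: "aut_cocycle (split_model M E) \<U> g"
    and cover: "y \<in> topspace (mtop M) \<Longrightarrow> y \<in> w y"
    and open_w: "y \<in> topspace (mtop M) \<Longrightarrow> openin (mtop M) (w y)"
    and u: "y \<in> topspace (mtop M) \<Longrightarrow> u y \<in> \<U>"
    and w_u: "y \<in> topspace (mtop M) \<Longrightarrow> w y \<subseteq> u y"
    and c_aut: "y \<in> topspace (mtop M) \<Longrightarrow> local_aut (split_model M E) (w y) (c y)"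
    and c_eq: "x \<in> topspace (mtop M) \<Longrightarrow> y \<in> topspace (mtop M) \<Longrightarrow> openin (mtop M) P \<Longrightarrow>
      P \<subseteq> w x \<Longrightarrow> P \<subseteq> w y \<Longrightarrow> s \<in> ext_sections M E P \<Longrightarrow> g (u x) (u y) P (c y P s) = c x P s"
begin

abbreviation X where "X \<equiv> topspace (mtop M)"

lemma open_U: "U \<in> \<U> \<Longrightarrow> openin (mtop M) U"
  using cocycle by (auto simp: aut_cocycle_def)

lemma g_aut: "U \<in> \<U> \<Longrightarrow> V \<in> \<U> \<Longrightarrow> local_aut (split_model M E) (U \<inter> V) (g U V)"
  using cocycle by (auto simp: aut_cocycle_def)

lemma g_cocycle:
  assumes "U \<in> \<U>" "V \<in> \<U>" "W \<in> \<U>" "openin (mtop M) P" "P \<subseteq> U" "P \<subseteq> V" "P \<subseteq> W" "s \<in> ext_sections M E P"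
  shows "g U V P (g V W P s) = g U W P s"
  using cocycle assms by (auto simp: aut_cocycle_def opens_in_def)

lemma g_diag:
  assumes "U \<in> \<U>" "openin (mtop M) P" "P \<subseteq> U" "s \<in> ext_sections M E P"
  shows "g U U P s = s"
  using aut_cocycle_diag[OF cocycle assms(1), of P s] assms by (simp add: opens_in_def)

lemma aut_section:
  assumes "local_aut (split_model M E) W \<alpha>" "openin (mtop M) P" "P \<subseteq> W" "s \<in> ext_sections M E P"
  shows "\<alpha> P s \<in> ext_sections M E P"
  using local_aut_carrier[OF assms(1), of P s] assms by (simp add: opens_in_def)

lemma aut_restrict:
  assumes "local_aut (split_model M E) W \<alpha>" "openin (mtop M) P" "P \<subseteq> W" "s \<in> ext_sections M E P"
    "openin (mtop M) P'" "P' \<subseteq> P"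
  shows "\<alpha> P' (restrict s P') = restrict (\<alpha> P s) P'"
  using assms unfolding local_aut_def by (simp add: opens_in_def)

lemma aut_hom:
  assumes "local_aut (split_model M E) W \<alpha>" "openin (mtop M) P" "P \<subseteq> W"
  shows "superalg_hom (split_model M E) P (split_model M E) P (\<alpha> P)"
  using assms unfolding local_aut_def by (simp add: opens_in_def)

text \<open>For open \<open>P \<subseteq> V \<inter> U \<inter> w y\<close>, the component at \<open>U \<in> \<U>\<close>, restricted to \<open>P\<close>, of
  the glued section that corresponds to \<open>t\<close> over \<open>V\<close>.\<close>

definition transported where
  "transported U y P t = g U (u y) P (c y P (restrict t P))"

definition glued_section where
  "glued_section V t = (\<lambda>U\<in>\<U>. \<lambda>y\<in>V \<inter> U. transported U y (V \<inter> U \<inter> w y) t y)"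

lemma transported_hom:
  assumes "U \<in> \<U>" "y \<in> X" "openin (mtop M) P" "P \<subseteq> U" "P \<subseteq> w y"
  shows "superalg_hom (split_model M E) P (split_model M E) P (\<lambda>s. g U (u y) P (c y P s))"
  using assms w_u[of y]
  by (intro superalg_hom_compose[OF aut_hom[OF c_aut] aut_hom[OF g_aut[OF _ u]]]) auto

context
  fixes V t assumes V: "openin (mtop M) V" and t: "t \<in> ext_sections M E V"
begin

lemma restrict_section: "openin (mtop M) P \<Longrightarrow> P \<subseteq> V \<Longrightarrow> restrict t P \<in> ext_sections M E P"
  using ext_sections_restrict[OF model _ _ t] .

context
  fixes U y P assumes U: "U \<in> \<U>" and y: "y \<in> X" and P: "openin (mtop M) P" "P \<subseteq> V" "P \<subseteq> U" "P \<subseteq> w y"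
begin

lemma P_uy: "P \<subseteq> u y"
  using P(4) w_u[OF y] by blast

lemma c_section: "c y P (restrict t P) \<in> ext_sections M E P"
  using aut_section[OF c_aut[OF y] P(1,4) restrict_section[OF P(1,2)]] .

lemma transported_section: "transported U y P t \<in> ext_sections M E P"
  unfolding transported_def using P(3) P_uy
  by (intro aut_section[OF g_aut[OF U u[OF y]] P(1) _ c_section]) blast

lemma transported_restrict:
  assumes "openin (mtop M) P'" "P' \<subseteq> P"
  shows "transported U y P' t = restrict (transported U y P t) P'"
proof -
  have "c y P' (restrict t P') = restrict (c y P (restrict t P)) P'"
    using aut_restrict[OF c_aut[OF y] P(1,4) restrict_section[OF P(1,2)] assms] assms(2)
    by (simp add: Int_absorb1)
  then show ?thesis
    unfolding transported_def
    using aut_restrict[OF g_aut[OF U u[OF y]] P(1) _ c_section assms] P(3) P_uy by simp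
qed

lemma transported_cong:
  assumes "x \<in> X" "P \<subseteq> w x"
  shows "transported U x P t = transported U y P t"
proof -
  have "c x P (restrict t P) = g (u x) (u y) P (c y P (restrict t P))"
    using c_eq[OF assms(1) y P(1) assms(2) P(4) restrict_section[OF P(1,2)]] by simp
  then show ?thesis
    unfolding transported_def
    using g_cocycle[OF U u[OF assms(1)] u[OF y] P(1,3) _ P_uy c_section] assms w_u by force
qed

lemma transported_g:
  assumes "U' \<in> \<U>" "P \<subseteq> U'"
  shows "g U' U P (transported U y P t) = transported U' y P t"
  unfolding transported_def by (rule g_cocycle[OF assms(1) U u[OF y] P(1) assms(2) P(3) P_uy c_section])

end

lemma V_X: "y \<in> V \<Longrightarrow> y \<in> X"
  using openin_subset[OF V] by blast

lemma glued_section_apply: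
  assumes U: "U \<in> \<U>" and x: "x \<in> X" and P: "openin (mtop M) P" "P \<subseteq> V" "P \<subseteq> U" "P \<subseteq> w x" and y: "y \<in> P"
  shows "glued_section V t U y = transported U x P t y"
proof -
  have yV: "y \<in> V" "y \<in> X" "y \<in> w y" "y \<in> U"
    using y P V_X cover by blast+
  let ?Q = "V \<inter> U \<inter> w y"
  have Q: "openin (mtop M) ?Q" "openin (mtop M) (P \<inter> ?Q)"
    using V open_U[OF U] open_w[OF yV(2)] P(1) by auto
  have "glued_section V t U y = transported U y ?Q t y"
    using U yV by (simp add: glued_section_def)
  also have "\<dots> = restrict (transported U y ?Q t) (P \<inter> ?Q) y"
    using yV y by simp
  also have "restrict (transported U y ?Q t) (P \<inter> ?Q) = transported U y (P \<inter> ?Q) t"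
    by (rule transported_restrict[OF U yV(2) Q(1) _ _ _ Q(2), symmetric]) auto
  also have "\<dots> = transported U x (P \<inter> ?Q) t"
    by (rule transported_cong[OF U yV(2) Q(2) _ _ _ x, symmetric]) (use P(2-4) in auto)
  also have "\<dots> y = transported U x P t y"
    using transported_restrict[OF U x P Q(2)] yV y by simp
  finally show ?thesis .
qed

lemma glued_section_restrict:
  assumes U: "U \<in> \<U>" and x: "x \<in> X" and P: "openin (mtop M) P" "P \<subseteq> V" "P \<subseteq> U" "P \<subseteq> w x"
  shows "restrict (glued_section V t U) P = transported U x P t"
  using glued_section_apply[OF assms] transported_section[OF assms]
  by (intro ext) (auto simp: ext_sections_def extensional_def restrict_def)

lemma open_Int3: "U \<in> \<U> \<Longrightarrow> y \<in> X \<Longrightarrow> openin (mtop M) (V \<inter> U \<inter> w y)"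
  using V open_U open_w by blast

lemma glued_section_component:
  assumes U: "U \<in> \<U>"
  shows "glued_section V t U \<in> ext_sections M E (V \<inter> U)"
proof (rule ext_sections_local[OF model])
  show "openin (mtop M) (V \<inter> U)"
    using V open_U[OF U] by blast
  show "glued_section V t U \<in> extensional (V \<inter> U)"
    using U by (simp add: glued_section_def)
  fix y assume "y \<in> V \<inter> U"
  then have y: "y \<in> V" "y \<in> U" "y \<in> X" using V_X by auto
  let ?P = "V \<inter> U \<inter> w y"
  have "transported U y ?P t \<in> ext_sections M E ?P"
    using transported_section[OF U y(3) open_Int3[OF U y(3)]] by blast
  moreover have "\<forall>x\<in>?P. glued_section V t U x = transported U y ?P t x"
    using glued_section_apply[OF U y(3) open_Int3[OF U y(3)]] by blast
  ultimately show "\<exists>Q s'. openin (mtop M) Q \<and> y \<in> Q \<and> Q \<subseteq> V \<inter> U \<and> s' \<in> ext_sections M E Q \<and>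
      (\<forall>x\<in>Q. glued_section V t U x = s' x)"
    using open_Int3[OF U y(3)] y cover[OF y(3)]
    by (intro exI[of _ ?P] exI[of _ "transported U y ?P t"]) auto
qed

lemma glued_section_match:
  assumes U: "U \<in> \<U>" "U' \<in> \<U>"
  shows "restrict (glued_section V t U) (V \<inter> U \<inter> U') =
    g U U' (V \<inter> U \<inter> U') (restrict (glued_section V t U') (V \<inter> U \<inter> U'))"
proof -
  let ?O = "V \<inter> U \<inter> U'" and ?s = "glued_section V t"
  have O: "openin (mtop M) ?O"
    using V open_U U by blast
  have sO: "restrict (?s U') ?O \<in> ext_sections M E ?O"
    using ext_sections_restrict[OF model O _ glued_section_component[OF U(2)]] by blast
  have gO: "g U U' ?O (restrict (?s U') ?O) \<in> ext_sections M E ?O"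
    using aut_section[OF g_aut[OF U] O _ sO] by blast
  have "?s U y = g U U' ?O (restrict (?s U') ?O) y" if y: "y \<in> ?O" for y
  proof -
    let ?P = "?O \<inter> w y"
    have yX: "y \<in> X" "y \<in> w y" using y V_X cover by auto
    have P: "openin (mtop M) ?P" using O open_w[OF yX(1)] by blast
    have "g U U' ?O (restrict (?s U') ?O) y = restrict (g U U' ?O (restrict (?s U') ?O)) ?P y"
      using y yX by simp
    also have "restrict (g U U' ?O (restrict (?s U') ?O)) ?P = g U U' ?P (restrict (restrict (?s U') ?O) ?P)"
      by (rule aut_restrict[OF g_aut[OF U] O _ sO P, symmetric]) auto
    also have "restrict (restrict (?s U') ?O) ?P = restrict (?s U') ?P"
      by (simp add: Int_absorb1)
    also have "\<dots> = transported U' y ?P t"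
      by (rule glued_section_restrict[OF U(2) yX(1) P]) auto
    also have "g U U' ?P \<dots> = transported U y ?P t"
      by (rule transported_g[OF U(2) yX(1) P _ _ _ U(1)]) auto
    also have "\<dots> y = ?s U y"
      by (rule glued_section_apply[OF U(1) yX(1) P, symmetric]) (use y yX in auto)
    finally show ?thesis by (rule sym)
  qed
  then show ?thesis
    using ext_sections_extensional[OF gO]
    by (intro ext) (auto simp: extensional_def restrict_def)
qed

lemma glued_section_in: "glued_section V t \<in> glue_sections M E (\<U>, g) V"
  using glued_section_component glued_section_match
  by (auto simp: glue_sections_def glued_section_def)

end

lemma transported_graded:
  assumes "openin (mtop M) V" "U \<in> \<U>" "y \<in> X" "openin (mtop M) P" "P \<subseteq> V" "P \<subseteq> U" "P \<subseteq> w y"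
  shows "t \<in> sp_even (split_model M E) V \<Longrightarrow> transported U y P t \<in> sp_even (split_model M E) P"
    and "t \<in> sp_odd (split_model M E) V \<Longrightarrow> transported U y P t \<in> sp_odd (split_model M E) P"
proof -
  note h = transported_hom[OF assms(2-4,6,7)]
  have "restrict t P \<in> ext_sections M E P" if "t \<in> ext_sections M E V"
    using ext_sections_restrict[OF model assms(4,5) that] .
  then have "t \<in> sp_even (split_model M E) V \<Longrightarrow> restrict t P \<in> sp_even (split_model M E) P"
    and "t \<in> sp_odd (split_model M E) V \<Longrightarrow> restrict t P \<in> sp_odd (split_model M E) P"
    using assms(5) by (auto simp: split_model_def)
  then show "t \<in> sp_even (split_model M E) V \<Longrightarrow> transported U y P t \<in> sp_even (split_model M E) P"
    and "t \<in> sp_odd (split_model M E) V \<Longrightarrow> transported U y P t \<in> sp_odd (split_model M E) P"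
    using h unfolding transported_def superalg_hom_def image_subset_iff by blast+
qed

lemma glued_section_eqI:
  assumes V: "openin (mtop M) V" and s: "s \<in> (\<Pi>\<^sub>E U\<in>\<U>. extensional (V \<inter> U))"
    and eq: "\<And>U y P. U \<in> \<U> \<Longrightarrow> y \<in> X \<Longrightarrow> openin (mtop M) P \<Longrightarrow> P \<subseteq> V \<Longrightarrow> P \<subseteq> U \<Longrightarrow> P \<subseteq> w y \<Longrightarrow>
      y \<in> P \<Longrightarrow> transported U y P t y = s U y"
  shows "glued_section V t = s"
proof (rule ext, rule ext)
  fix U y
  show "glued_section V t U y = s U y"
  proof (cases "U \<in> \<U> \<and> y \<in> V \<inter> U")
    case True
    then have "y \<in> X" using V openin_subset by blast
    then have "transported U y (V \<inter> U \<inter> w y) t y = s U y"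
      by (intro eq) (use True open_U V open_w cover in \<open>auto intro!: openin_Int\<close>)
    with True show ?thesis
      by (simp add: glued_section_def)
  next
    case False
    then show ?thesis
      using PiE_mem[OF s, of U] PiE_arb[OF s, of U] by (cases "U \<in> \<U>") (auto simp: glued_section_def extensional_def)
  qed
qed

lemma glued_section_hom:
  assumes V: "openin (mtop M) V"
  shows "superalg_hom (split_model M E) V (glued_superspace M E (\<U>, g)) V (glued_section V)"
proof -
  have rest: "restrict t P \<in> ext_sections M E P"
    if "t \<in> ext_sections M E V" "openin (mtop M) P" "P \<subseteq> V" for t P
    using ext_sections_restrict[OF model that(2,3,1)] .
  have at_point: "glued_section V t U y = transported U y P t y"
    if "t \<in> ext_sections M E V" "U \<in> \<U>" "y \<in> X" "openin (mtop M) P" "P \<subseteq> V" "P \<subseteq> U" "P \<subseteq> w y" "y \<in> P"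
    for t U y P
    using glued_section_apply[OF V that] .
  have yV: "y \<in> V" "y \<in> U" if "y \<in> P" "P \<subseteq> V" "P \<subseteq> U" for P U :: "'a set" and y
    using that by auto
  have mult: "glued_section V (\<lambda>y\<in>V. wedge (s y) (s' y)) =
      (\<lambda>U\<in>\<U>. \<lambda>y\<in>V \<inter> U. wedge (glued_section V s U y) (glued_section V s' U y))"
    if s: "s \<in> ext_sections M E V" "s' \<in> ext_sections M E V" for s s'
  proof (rule glued_section_eqI[OF V])
    fix U y P assume a: "U \<in> \<U>" "y \<in> X" "openin (mtop M) P" "P \<subseteq> V" "P \<subseteq> U" "P \<subseteq> w y" "y \<in> P"
    have "restrict (\<lambda>y\<in>V. wedge (s y) (s' y)) P = restrict s P \<otimes>\<^bsub>ext_section_alg M E P\<^esub> restrict s' P"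
      using a(4) by (auto simp: restrict_def fun_eq_iff)
    moreover have "g U (u y) P (c y P (restrict s P \<otimes>\<^bsub>ext_section_alg M E P\<^esub> restrict s' P)) =
        transported U y P s \<otimes>\<^bsub>ext_section_alg M E P\<^esub> transported U y P s'"
      using transported_hom[OF a(1-3,5,6)] ring_hom_mult[OF _ rest[OF s(1) a(3,4), folded ext_section_alg_simps(1)]
        rest[OF s(2) a(3,4), folded ext_section_alg_simps(1)]]
      unfolding superalg_hom_def transported_def split_model_simps by blast
    ultimately have "transported U y P (\<lambda>y\<in>V. wedge (s y) (s' y)) y =
        wedge (transported U y P s y) (transported U y P s' y)"
      using a(7) unfolding transported_def by simp
    then show "transported U y P (\<lambda>y\<in>V. wedge (s y) (s' y)) y =
        (\<lambda>U\<in>\<U>. \<lambda>y\<in>V \<inter> U. wedge (glued_section V s U y) (glued_section V s' U y)) U y"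
      using at_point[OF s(1) a] at_point[OF s(2) a] a(1) yV[OF a(7,4,5)] by simp
  qed simp
  have add: "glued_section V (\<lambda>y\<in>V. \<lambda>ls. s y ls + s' y ls) =
      (\<lambda>U\<in>\<U>. \<lambda>y\<in>V \<inter> U. \<lambda>ls. glued_section V s U y ls + glued_section V s' U y ls)"
    if s: "s \<in> ext_sections M E V" "s' \<in> ext_sections M E V" for s s'
  proof (rule glued_section_eqI[OF V])
    fix U y P assume a: "U \<in> \<U>" "y \<in> X" "openin (mtop M) P" "P \<subseteq> V" "P \<subseteq> U" "P \<subseteq> w y" "y \<in> P"
    have "restrict (\<lambda>y\<in>V. \<lambda>ls. s y ls + s' y ls) P = restrict s P \<oplus>\<^bsub>ext_section_alg M E P\<^esub> restrict s' P"
      using a(4) by (auto simp: restrict_def fun_eq_iff)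
    moreover have "g U (u y) P (c y P (restrict s P \<oplus>\<^bsub>ext_section_alg M E P\<^esub> restrict s' P)) =
        transported U y P s \<oplus>\<^bsub>ext_section_alg M E P\<^esub> transported U y P s'"
      using transported_hom[OF a(1-3,5,6)] ring_hom_add[OF _ rest[OF s(1) a(3,4), folded ext_section_alg_simps(1)]
        rest[OF s(2) a(3,4), folded ext_section_alg_simps(1)]]
      unfolding superalg_hom_def transported_def split_model_simps by blast
    ultimately have "transported U y P (\<lambda>y\<in>V. \<lambda>ls. s y ls + s' y ls) y =
        (\<lambda>ls. transported U y P s y ls + transported U y P s' y ls)"
      using a(7) unfolding transported_def by simp
    then show "transported U y P (\<lambda>y\<in>V. \<lambda>ls. s y ls + s' y ls) y =
        (\<lambda>U\<in>\<U>. \<lambda>y\<in>V \<inter> U. \<lambda>ls. glued_section V s U y ls + glued_section V s' U y ls) U y"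
      using at_point[OF s(1) a] at_point[OF s(2) a] a(1) yV[OF a(7,4,5)] by simp
  qed simp
  have smult: "glued_section V (\<lambda>y\<in>V. \<lambda>ls. k * s y ls) =
      (\<lambda>U\<in>\<U>. \<lambda>y\<in>V \<inter> U. \<lambda>ls. k * glued_section V s U y ls)"
    if s: "s \<in> ext_sections M E V" for s k
  proof (rule glued_section_eqI[OF V])
    fix U y P assume a: "U \<in> \<U>" "y \<in> X" "openin (mtop M) P" "P \<subseteq> V" "P \<subseteq> U" "P \<subseteq> w y" "y \<in> P"
    have "restrict (\<lambda>y\<in>V. \<lambda>ls. k * s y ls) P = k \<odot>\<^bsub>ext_section_alg M E P\<^esub> restrict s P"
      using a(4) by (auto simp: restrict_def fun_eq_iff)
    moreover have "g U (u y) P (c y P (k \<odot>\<^bsub>ext_section_alg M E P\<^esub> restrict s P)) =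
        k \<odot>\<^bsub>ext_section_alg M E P\<^esub> transported U y P s"
      using transported_hom[OF a(1-3,5,6)] rest[OF s a(3,4)]
      unfolding superalg_hom_def transported_def split_model_simps ext_section_alg_simps(1) by blast
    ultimately have "transported U y P (\<lambda>y\<in>V. \<lambda>ls. k * s y ls) y = (\<lambda>ls. k * transported U y P s y ls)"
      using a(7) unfolding transported_def by simp
    then show "transported U y P (\<lambda>y\<in>V. \<lambda>ls. k * s y ls) y =
        (\<lambda>U\<in>\<U>. \<lambda>y\<in>V \<inter> U. \<lambda>ls. k * glued_section V s U y ls) U y"
      using at_point[OF s a] a(1) yV[OF a(7,4,5)] by simp
  qed simp
  have one: "glued_section V (\<lambda>y\<in>V. form_one) = (\<lambda>U\<in>\<U>. \<lambda>y\<in>V \<inter> U. form_one)"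
  proof (rule glued_section_eqI[OF V])
    fix U y P assume a: "U \<in> \<U>" "y \<in> X" "openin (mtop M) P" "P \<subseteq> V" "P \<subseteq> U" "P \<subseteq> w y" "y \<in> P"
    have "restrict (\<lambda>y\<in>V. form_one) P = (\<one>\<^bsub>ext_section_alg M E P\<^esub> :: 'a \<Rightarrow> 'e form)"
      using a(4) by (auto simp: restrict_def fun_eq_iff)
    moreover have "g U (u y) P (c y P \<one>\<^bsub>ext_section_alg M E P\<^esub>) = \<one>\<^bsub>ext_section_alg M E P\<^esub>"
      using transported_hom[OF a(1-3,5,6)] ring_hom_one
      unfolding superalg_hom_def split_model_simps by blast
    ultimately show "transported U y P (\<lambda>y\<in>V. form_one) y = (\<lambda>U\<in>\<U>. \<lambda>y\<in>V \<inter> U. form_one) U y"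
      using a(1,7) yV[OF a(7,4,5)] unfolding transported_def by simp
  qed simp
  have grading: "(s \<in> sp_even (split_model M E) V \<longrightarrow> glued_section V s U \<in> sp_even (split_model M E) (V \<inter> U)) \<and>
      (s \<in> sp_odd (split_model M E) V \<longrightarrow> glued_section V s U \<in> sp_odd (split_model M E) (V \<inter> U))"
    if s: "s \<in> ext_sections M E V" and U: "U \<in> \<U>" for s U
  proof -
    have "(s \<in> sp_even (split_model M E) V \<longrightarrow> odd (length ls) \<longrightarrow> glued_section V s U y ls = 0) \<and>
        (s \<in> sp_odd (split_model M E) V \<longrightarrow> even (length ls) \<longrightarrow> glued_section V s U y ls = 0)"
      if y: "y \<in> V \<inter> U" for y ls
    proof -
      have yX: "y \<in> X" using y V openin_subset by blast
      have P: "openin (mtop M) (V \<inter> U \<inter> w y)" "V \<inter> U \<inter> w y \<subseteq> V" "V \<inter> U \<inter> w y \<subseteq> U" "V \<inter> U \<inter> w y \<subseteq> w y"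
        "y \<in> V \<inter> U \<inter> w y"
        using V open_U[OF U] open_w[OF yX] cover[OF yX] y by auto
      show ?thesis
        using transported_graded[OF V U yX P(1-4), of s] at_point[OF s U yX P] P(5)
        by (auto simp: split_model_def)
    qed
    then show ?thesis
      using glued_section_component[OF V s U] by (auto simp: split_model_def)
  qed
  have in_glue: "glued_section V t \<in> glue_sections M E (\<U>, g) V" if "t \<in> ext_sections M E V" for t
    using glued_section_in[OF V that] .
  have graded: "sp_even (split_model M E) V \<subseteq> ext_sections M E V" "sp_odd (split_model M E) V \<subseteq> ext_sections M E V"
    by (auto simp: split_model_def)
  show ?thesis
    unfolding superalg_hom_def
  proof (intro conjI allI ballI)
    show "glued_section V \<in> ring_hom (sp_alg (split_model M E) V) (sp_alg (glued_superspace M E (\<U>, g)) V)"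
    proof (rule ring_hom_memI)
      fix x y assume xy: "x \<in> carrier (sp_alg (split_model M E) V)" "y \<in> carrier (sp_alg (split_model M E) V)"
      show "glued_section V (x \<otimes>\<^bsub>sp_alg (split_model M E) V\<^esub> y) =
          glued_section V x \<otimes>\<^bsub>sp_alg (glued_superspace M E (\<U>, g)) V\<^esub> glued_section V y"
        using mult[of x y] xy by (simp add: glued_superspace_def cong: restrict_cong)
      show "glued_section V (x \<oplus>\<^bsub>sp_alg (split_model M E) V\<^esub> y) =
          glued_section V x \<oplus>\<^bsub>sp_alg (glued_superspace M E (\<U>, g)) V\<^esub> glued_section V y"
        using add[of x y] xy by (simp add: glued_superspace_def cong: restrict_cong)
    qed (use in_glue one in \<open>auto simp: glued_superspace_def\<close>)
    show "glued_section V (k \<odot>\<^bsub>sp_alg (split_model M E) V\<^esub> s) =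
        k \<odot>\<^bsub>sp_alg (glued_superspace M E (\<U>, g)) V\<^esub> glued_section V s"
      if "s \<in> carrier (sp_alg (split_model M E) V)" for k s
      using smult[of s k] that by (simp add: glued_superspace_def cong: restrict_cong)
    show "glued_section V ` sp_even (split_model M E) V \<subseteq> sp_even (glued_superspace M E (\<U>, g)) V"
      "glued_section V ` sp_odd (split_model M E) V \<subseteq> sp_odd (glued_superspace M E (\<U>, g)) V"
      using grading in_glue graded by (auto simp: glued_superspace_def)
  qed
qed

lemma transported_own:
  assumes "openin (mtop M) V" "t \<in> ext_sections M E V" "y \<in> X" "openin (mtop M) P" "P \<subseteq> V" "P \<subseteq> w y"
  shows "transported (u y) y P t = c y P (restrict t P)"
  unfolding transported_def using assms w_u[OF assms(3)]
  by (intro g_diag[OF u[OF assms(3)] assms(4)] aut_section[OF c_aut[OF assms(3)]]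
    ext_sections_restrict[OF model]) auto

lemma c_inj:
  assumes "y \<in> X" "openin (mtop M) P" "P \<subseteq> w y" "s \<in> ext_sections M E P" "s' \<in> ext_sections M E P"
  shows "c y P s = c y P s' \<longleftrightarrow> s = s'"
  using local_aut_inj[OF c_aut[OF assms(1)], of P s s'] assms by (simp add: opens_in_def)

lemma glued_section_inj:
  assumes V: "openin (mtop M) V" and t: "t \<in> ext_sections M E V" "t' \<in> ext_sections M E V"
    and eq: "glued_section V t = glued_section V t'"
  shows "t = t'"
proof (rule extensionalityI)
  show "t \<in> extensional V" "t' \<in> extensional V"
    using t by (auto intro: ext_sections_extensional)
  fix y assume y: "y \<in> V"
  then have yX: "y \<in> X" using V openin_subset by blast
  let ?P = "V \<inter> w y"
  have P: "openin (mtop M) ?P" "?P \<subseteq> V" "?P \<subseteq> u y" "?P \<subseteq> w y"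
    using V open_w[OF yX] w_u[OF yX] by auto
  have "transported (u y) y ?P t = transported (u y) y ?P t'"
    using glued_section_restrict[OF V t(1) u[OF yX] yX P] glued_section_restrict[OF V t(2) u[OF yX] yX P] eq
    by simp
  then have "restrict t ?P = restrict t' ?P"
    using transported_own[OF V t(1) yX P(1,2,4)] transported_own[OF V t(2) yX P(1,2,4)]
      c_inj[OF yX P(1,4) restrict_section[OF V t(1) P(1,2)] restrict_section[OF V t(2) P(1,2)]] by simp
  from fun_cong[OF this, of y] show "t y = t' y"
    using y cover[OF yX] by simp
qed

lemma glued_section_surj:
  assumes V: "openin (mtop M) V" and s: "s \<in> glue_sections M E (\<U>, g) V"
  obtains t where "t \<in> ext_sections M E V" "glued_section V t = s"
proof -
  have sU: "s U \<in> ext_sections M E (V \<inter> U)" if "U \<in> \<U>" for U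
    using s that by (auto simp: glue_sections_def PiE_iff)
  have match: "restrict (s U) P = g U U' P (restrict (s U') P)"
    if U: "U \<in> \<U>" "U' \<in> \<U>" and P: "openin (mtop M) P" "P \<subseteq> V" "P \<subseteq> U" "P \<subseteq> U'" for U U' P
  proof -
    let ?O = "V \<inter> U \<inter> U'"
    have O: "openin (mtop M) ?O" "P \<subseteq> ?O" using V open_U U P by auto
    have r: "restrict (s U') ?O \<in> ext_sections M E ?O"
      by (rule ext_sections_restrict[OF model O(1) _ sU[OF U(2)]]) blast
    have "restrict (s U) ?O = g U U' ?O (restrict (s U') ?O)"
      using s U by (auto simp: glue_sections_def)
    then have "restrict (restrict (s U) ?O) P = restrict (g U U' ?O (restrict (s U') ?O)) P"
      by simp
    also have "\<dots> = g U U' P (restrict (restrict (s U') ?O) P)"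
      by (rule aut_restrict[OF g_aut[OF U] O(1) _ r P(1) O(2), symmetric]) blast
    finally show ?thesis
      using O(2) by (simp only: restrict_restrict Int_absorb1)
  qed
  have own_sec: "restrict (s (u y)) P \<in> ext_sections M E P"
    if "y \<in> X" "openin (mtop M) P" "P \<subseteq> V" "P \<subseteq> w y" for y P
    using that w_u[of y] by (intro ext_sections_restrict[OF model _ _ sU[OF u]]) auto
  have open_P: "openin (mtop M) (V \<inter> w y)" if "y \<in> X" for y
    using V open_w[OF that] by blast
  have "\<exists>e. e \<in> ext_sections M E (V \<inter> w y) \<and> c y (V \<inter> w y) e = restrict (s (u y)) (V \<inter> w y)"
    if y: "y \<in> X" for y
  proof -
    have "bij_betw (c y (V \<inter> w y)) (ext_sections M E (V \<inter> w y)) (ext_sections M E (V \<inter> w y))"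
      using c_aut[OF y] open_P[OF y] unfolding local_aut_def by (simp add: opens_in_def)
    moreover have "restrict (s (u y)) (V \<inter> w y) \<in> ext_sections M E (V \<inter> w y)"
      using own_sec[OF y open_P[OF y]] by blast
    ultimately have "restrict (s (u y)) (V \<inter> w y) \<in> c y (V \<inter> w y) ` ext_sections M E (V \<inter> w y)"
      by (simp add: bij_betw_imp_surj_on)
    then show ?thesis by force
  qed
  then obtain e where e: "\<And>y. y \<in> X \<Longrightarrow> e y \<in> ext_sections M E (V \<inter> w y)"
    and ce: "\<And>y. y \<in> X \<Longrightarrow> c y (V \<inter> w y) (e y) = restrict (s (u y)) (V \<inter> w y)"
    by metis
  have eP: "restrict (e y) P \<in> ext_sections M E P"
    if "y \<in> X" "openin (mtop M) P" "P \<subseteq> V" "P \<subseteq> w y" for y P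
    using that by (intro ext_sections_restrict[OF model _ _ e]) auto
  have ceP: "c y P (restrict (e y) P) = restrict (s (u y)) P"
    if y: "y \<in> X" and P: "openin (mtop M) P" "P \<subseteq> V" "P \<subseteq> w y" for y P
  proof -
    have "c y P (restrict (e y) P) = restrict (c y (V \<inter> w y) (e y)) P"
      by (rule aut_restrict[OF c_aut[OF y] open_P[OF y] _ e[OF y] P(1)]) (use P in auto)
    also have "\<dots> = restrict (s (u y)) P"
      using P by (simp only: ce[OF y] restrict_restrict le_inf_iff Int_absorb1 simp_thms)
    finally show ?thesis .
  qed
  have agree: "e x z = e y z" if x: "x \<in> X" and y: "y \<in> X" and z: "z \<in> V" "z \<in> w x" "z \<in> w y" for x y z
  proof -
    let ?P = "V \<inter> w x \<inter> w y"
    have P: "openin (mtop M) ?P" "?P \<subseteq> V" "?P \<subseteq> w x" "?P \<subseteq> w y" "?P \<subseteq> u x" "?P \<subseteq> u y"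
      using open_P[OF x] open_w[OF y] w_u[OF x] w_u[OF y] by auto
    have "c x ?P (restrict (e x) ?P) = restrict (s (u x)) ?P"
      by (rule ceP[OF x P(1-3)])
    also have "\<dots> = g (u x) (u y) ?P (restrict (s (u y)) ?P)"
      by (rule match[OF u[OF x] u[OF y] P(1,2,5,6)])
    also have "restrict (s (u y)) ?P = c y ?P (restrict (e y) ?P)"
      by (rule ceP[OF y P(1,2,4), symmetric])
    also have "g (u x) (u y) ?P \<dots> = c x ?P (restrict (e y) ?P)"
      by (rule c_eq[OF x y P(1,3,4) eP[OF y P(1,2,4)]])
    finally have "restrict (e x) ?P = restrict (e y) ?P"
      using c_inj[OF x P(1,3) eP[OF x P(1-3)] eP[OF y P(1,2,4)]] by blast
    from fun_cong[OF this, of z] show ?thesis using z by simp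
  qed
  define t where "t = (\<lambda>y\<in>V. e y y)"
  have VX: "y \<in> X" if "y \<in> V" for y using that V openin_subset by blast
  have te: "t z = e y z" if "y \<in> X" "z \<in> V" "z \<in> w y" for y z
    using that agree[OF VX[OF that(2)] that(1,2) _ that(3)] cover[OF VX[OF that(2)]] by (simp add: t_def)
  have t: "t \<in> ext_sections M E V"
  proof (rule ext_sections_local[OF model V])
    show "t \<in> extensional V" by (simp add: t_def)
    fix y assume y: "y \<in> V"
    then show "\<exists>Q s'. openin (mtop M) Q \<and> y \<in> Q \<and> Q \<subseteq> V \<and> s' \<in> ext_sections M E Q \<and> (\<forall>x\<in>Q. t x = s' x)"
      using open_P[OF VX[OF y]] cover[OF VX[OF y]] e[OF VX[OF y]] te[OF VX[OF y]]
      by (intro exI[of _ "V \<inter> w y"] exI[of _ "e y"]) auto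
  qed
  have "glued_section V t = s"
  proof (rule glued_section_eqI[OF V])
    show "s \<in> (\<Pi>\<^sub>E U\<in>\<U>. extensional (V \<inter> U))"
      using s sU[THEN ext_sections_extensional] by (auto simp: glue_sections_def PiE_iff)
    fix U y P assume a: "U \<in> \<U>" "y \<in> X" "openin (mtop M) P" "P \<subseteq> V" "P \<subseteq> U" "P \<subseteq> w y" "y \<in> P"
    have "restrict t P = restrict (e y) P"
      using te[OF a(2)] a(4,6) by (intro restrict_ext) blast
    then have "transported U y P t = g U (u y) P (restrict (s (u y)) P)"
      unfolding transported_def using ceP[OF a(2-4,6)] by simp
    also have "\<dots> = restrict (s U) P"
      by (rule match[OF a(1) u[OF a(2)] a(3-5), symmetric]) (use a(6) w_u[OF a(2)] in blast)
    finally show "transported U y P t y = s U y"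
      using a(7) by simp
  qed
  with t show ?thesis by (rule that)
qed

lemma glued_section_bij:
  assumes V: "openin (mtop M) V"
  shows "bij_betw (glued_section V) (ext_sections M E V) (glue_sections M E (\<U>, g) V)"
  unfolding bij_betw_def inj_on_def
  using glued_section_inj[OF V] glued_section_in[OF V] glued_section_surj[OF V] by (blast intro: sym)

lemma glued_section_restrict_open:
  assumes V: "openin (mtop M) V" "openin (mtop M) V'" "V' \<subseteq> V" and t: "t \<in> ext_sections M E V"
  shows "glued_section V' (restrict t V') = (\<lambda>U\<in>\<U>. restrict (glued_section V t U) (V' \<inter> U))"
proof (rule glued_section_eqI[OF V(2)])
  fix U y P assume a: "U \<in> \<U>" "y \<in> X" "openin (mtop M) P" "P \<subseteq> V'" "P \<subseteq> U" "P \<subseteq> w y" "y \<in> P"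
  have "transported U y P (restrict t V') = transported U y P t"
    using a(4) by (simp add: transported_def Int_absorb1)
  moreover have "glued_section V t U y = transported U y P t y"
    by (rule glued_section_apply[OF V(1) t a(1-3) _ a(5-7)]) (use a(4) V(3) in blast)
  ultimately show "transported U y P (restrict t V') y = (\<lambda>U\<in>\<U>. restrict (glued_section V t U) (V' \<inter> U)) U y"
    using a(1,4,5,7) by auto
qed simp

lemma glued_section_reflect_one:
  assumes V: "openin (mtop M) V" and t: "t \<in> ext_sections M E V" "t' \<in> ext_sections M E V"
    and one: "glued_section V t \<otimes>\<^bsub>sp_alg (glued_superspace M E (\<U>, g)) V\<^esub> glued_section V t' =
      \<one>\<^bsub>sp_alg (glued_superspace M E (\<U>, g)) V\<^esub>"
  shows "t \<otimes>\<^bsub>ext_section_alg M E V\<^esub> t' = \<one>\<^bsub>ext_section_alg M E V\<^esub>"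
proof -
  have "wedge (t y) (t' y) = form_one" if y: "y \<in> V" for y
  proof -
    have yX: "y \<in> X" using y V openin_subset by blast
    let ?P = "V \<inter> w y"
    let ?A = "ext_section_alg M E ?P"
    have P: "openin (mtop M) ?P" "?P \<subseteq> V" "?P \<subseteq> u y" "?P \<subseteq> w y"
      using V open_w[OF yX] w_u[OF yX] by auto
    note tP = restrict_section[OF V t(1) P(1,2)] restrict_section[OF V t(2) P(1,2)]
    have "c y ?P (restrict t ?P) \<otimes>\<^bsub>?A\<^esub> c y ?P (restrict t' ?P) = \<one>\<^bsub>?A\<^esub>"
    proof (unfold ext_section_alg_simps, rule restrict_ext)
      fix z assume z: "z \<in> ?P"
      have "wedge (glued_section V t (u y) z) (glued_section V t' (u y) z) = form_one"
        using fun_cong[OF fun_cong[OF one, of "u y"], of z] u[OF yX] z P(3)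
        by (auto simp: glued_superspace_def)
      then show "wedge (c y ?P (restrict t ?P) z) (c y ?P (restrict t' ?P) z) = form_one"
        using glued_section_apply[OF V t(1) u[OF yX] yX P z] glued_section_apply[OF V t(2) u[OF yX] yX P z]
          transported_own[OF V t(1) yX P(1,2,4)] transported_own[OF V t(2) yX P(1,2,4)] by simp
    qed
    then have "restrict t ?P \<otimes>\<^bsub>?A\<^esub> restrict t' ?P = \<one>\<^bsub>?A\<^esub>"
      using c_aut[OF yX] P(1) tP unfolding local_aut_def split_model_simps
      by (simp only: opens_in_def split_model_simps mem_Collect_eq ext_section_alg_simps(1)) blast
    from fun_cong[OF this, of y] show ?thesis
      using y cover[OF yX] by simp
  qed
  then show ?thesis
    by (auto intro!: restrict_ext)
qed

lemma glued_split: "sm_split M E (\<U>, g)"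
proof -
  let ?G = "glued_superspace M E (\<U>, g)" and ?S = "split_model M E"
  have G: "sp_top ?G = mtop M" "\<And>W. carrier (sp_alg ?G W) = glue_sections M E (\<U>, g) W"
    "\<And>W W' s. sp_res ?G W W' s = (\<lambda>U\<in>\<U>. restrict (s U) (W' \<inter> U))"
    by (simp_all add: glued_superspace_def)
  have pre: "preim (mtop M) (\<lambda>y. y) V = V" if "openin (mtop M) V" for V
    using openin_subset[OF that] by (auto simp: preim_def)
  have "superspace_morphism ?G ?S (\<lambda>y. y) glued_section"
    unfolding superspace_morphism_def
  proof (intro conjI allI impI ballI)
    show "continuous_map (sp_top ?G) (sp_top ?S) (\<lambda>y. y)"
      by (simp add: G)
    show "superalg_hom ?S V ?G (preim (sp_top ?G) (\<lambda>y. y) V) (glued_section V)" if "openin (sp_top ?S) V" for V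
      using glued_section_hom[of V] that pre[of V] by (simp add: G)
    show "glued_section V' (sp_res ?S V V' a) =
        sp_res ?G (preim (sp_top ?G) (\<lambda>y. y) V) (preim (sp_top ?G) (\<lambda>y. y) V') (glued_section V a)"
      if "openin (sp_top ?S) V" "openin (sp_top ?S) V'" "V' \<subseteq> V" "a \<in> carrier (sp_alg ?S V)" for V V' a
      using that glued_section_restrict_open[of V V' a] pre[of V'] by (simp add: G)
    fix V a y
    assume "openin (sp_top ?S) V" "a \<in> carrier (sp_alg ?S V)"
      and ex: "\<exists>W. openin (sp_top ?G) W \<and> y \<in> W \<and> W \<subseteq> preim (sp_top ?G) (\<lambda>y. y) V \<and>
        sp_res ?G (preim (sp_top ?G) (\<lambda>y. y) V) W (glued_section V a) \<in> Units (sp_alg ?G W)"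
    then have V: "openin (mtop M) V" and a: "a \<in> ext_sections M E V" by simp_all
    from ex obtain W where W: "openin (mtop M) W" "y \<in> W" "W \<subseteq> V"
      and unit: "sp_res ?G V W (glued_section V a) \<in> Units (sp_alg ?G W)"
      using pre[OF V] unfolding G(1) by auto
    have aW: "restrict a W \<in> ext_sections M E W"
      using ext_sections_restrict[OF model W(1,3) a] .
    have "glued_section W (restrict a W) \<in> Units (sp_alg ?G W)"
      using unit glued_section_restrict_open[OF V W(1,3) a] by (simp add: G)
    then obtain b where b: "b \<in> glue_sections M E (\<U>, g) W"
      "b \<otimes>\<^bsub>sp_alg ?G W\<^esub> glued_section W (restrict a W) = \<one>\<^bsub>sp_alg ?G W\<^esub>"
      "glued_section W (restrict a W) \<otimes>\<^bsub>sp_alg ?G W\<^esub> b = \<one>\<^bsub>sp_alg ?G W\<^esub>"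
      by (auto simp: Units_def G)
    obtain b' where b': "b' \<in> ext_sections M E W" "glued_section W b' = b"
      using glued_section_surj[OF W(1) b(1)] .
    have "restrict a W \<in> Units (ext_section_alg M E W)"
      unfolding Units_def ext_section_alg_simps(1)
      using aW b'(1) glued_section_reflect_one[OF W(1) b'(1) aW] glued_section_reflect_one[OF W(1) aW b'(1)] b b'(2)
      by blast
    then show "\<exists>W'. openin (sp_top ?S) W' \<and> y \<in> W' \<and> W' \<subseteq> V \<and> sp_res ?S V W' a \<in> Units (sp_alg ?S W')"
      using W by auto
  qed
  moreover have "homeomorphic_map (sp_top ?G) (sp_top ?S) (\<lambda>y. y)"
    using homeomorphic_map_id[of "mtop M"] by (simp add: G id_def)
  moreover have "bij_betw (glued_section V) (carrier (sp_alg ?S V)) (carrier (sp_alg ?G (preim (sp_top ?G) (\<lambda>y. y) V)))"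
    if "openin (sp_top ?S) V" for V
    using glued_section_bij[of V] that pre[of V] by (simp add: G)
  ultimately show ?thesis
    unfolding sm_split_def superspace_isomorphic_def by blast
qed

end

lemma sm_split_if_cohomologous_trivial:
  fixes M :: "'a cmfd" and E :: "('a, 'e) vbundle"
  assumes E: "is_model M E" and coc: "aut_cocycle (split_model M E) \<U> g"
    and triv: "aut_cohomologous (split_model M E) (\<A>, e) (\<U>, g)"
    and e: "\<And>A B P s. A \<in> \<A> \<Longrightarrow> B \<in> \<A> \<Longrightarrow> openin (mtop M) P \<Longrightarrow> s \<in> ext_sections M E P \<Longrightarrow> e A B P s = s"
  shows "sm_split M E (\<U>, g)"
proof -
  let ?S = "split_model M E" and ?X = "topspace (mtop M)"
  obtain w a b \<gamma> where 1: "\<forall>y\<in>?X.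
     y \<in> w y \<and> openin (mtop M) (w y) \<and> a y \<in> \<A> \<and> w y \<subseteq> a y \<and> b y \<in> \<U> \<and> w y \<subseteq> b y \<and>
     local_aut ?S (w y) (\<gamma> y) \<and>
     (\<forall>x\<in>?X. \<forall>P\<in>opens_in ?S (w x \<inter> w y). \<forall>s\<in>ext_sections M E P.
        g (b x) (b y) P (\<gamma> y P s) = \<gamma> x P (e (a x) (a y) P s))"
    using triv unfolding aut_cohomologous_def split_model_simps ext_section_alg_simps(1) by blast
  have w: "y \<in> w y" "openin (mtop M) (w y)" "a y \<in> \<A>" "b y \<in> \<U>" "w y \<subseteq> b y" "local_aut ?S (w y) (\<gamma> y)"
    if "y \<in> ?X" for y
    using bspec[OF 1 that] by blast+
  have \<gamma>: "g (b x) (b y) P (\<gamma> y P s) = \<gamma> x P (e (a x) (a y) P s)"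
    if "x \<in> ?X" "y \<in> ?X" "P \<in> opens_in ?S (w x \<inter> w y)" "s \<in> ext_sections M E P" for x y P s
    using bspec[OF 1 that(2)] that by blast
  have "trivialised_cocycle M E \<U> g w b \<gamma>"
  proof
    show "g (b x) (b y) P (\<gamma> y P s) = \<gamma> x P s"
      if "x \<in> ?X" "y \<in> ?X" "openin (mtop M) P" "P \<subseteq> w x" "P \<subseteq> w y" "s \<in> ext_sections M E P" for x y P s
      using \<gamma>[OF that(1,2) _ that(6)] e[OF w(3)[OF that(1)] w(3)[OF that(2)] that(3,6)] that
      by (simp add: opens_in_def)
  qed (use E coc w in auto)
  then show ?thesis
    by (rule trivialised_cocycle.glued_split)
qed

section \<open>The class of the total space\<close>

lemma aut_subsheaf_G_carrier:
  assumes "is_model M E"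
  shows "aut_subsheaf (split_model M E) (G_carrier M E j)"
  unfolding aut_subsheaf_def
proof (intro allI ballI conjI impI)
  fix W \<alpha> assume \<alpha>: "\<alpha> \<in> G_carrier M E j W"
  then show \<alpha>': "\<alpha> \<in> sheaf_auts (split_model M E) W"
    by (simp add: G_carrier_def)
  then show "local_aut (split_model M E) W \<alpha>"
    by (rule local_aut_sheaf_auts[OF assms])
  fix W' assume "W' \<subseteq> W"
  then have sub: "V \<in> opens_in (split_model M E) W" if "V \<in> opens_in (split_model M E) W'" for V
    using that opens_in_trans by blast
  have trans: "V' \<in> opens_in (split_model M E) W'"
    if "V' \<in> opens_in (split_model M E) V" "V \<in> opens_in (split_model M E) W'" for V V'
    using that by (auto simp: opens_in_def)
  have "restrict \<alpha> (opens_in (split_model M E) W') \<in> sheaf_auts (split_model M E) W'"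
    using \<alpha>' sub trans unfolding sheaf_auts_def by auto
  then show "restrict \<alpha> (opens_in (split_model M E) W') \<in> G_carrier M E j W'"
    using \<alpha> sub unfolding G_carrier_def by auto
qed

text \<open>At a preimage under \<open>i\<close> that is not open, \<open>\<beta>\<close> and its restriction take the same junk value.\<close>

lemma aut_subsheaf_rel:
  assumes X: "is_model X VX" and Y: "is_model Y VY"
  shows "aut_subsheaf (split_model Y VY) (\<lambda>W. {\<alpha> \<in> G_carrier Y VY j W.
    \<exists>\<beta>\<in>G_carrier X VX j (preim (mtop X) i W). restricts_to X VX Y VY i p W \<alpha> \<beta>})"
  unfolding aut_subsheaf_def
proof (intro allI ballI conjI impI)
  let ?SX = "split_model X VX" and ?SY = "split_model Y VY"
  fix W \<alpha> assume "\<alpha> \<in> {\<alpha> \<in> G_carrier Y VY j W.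
    \<exists>\<beta>\<in>G_carrier X VX j (preim (mtop X) i W). restricts_to X VX Y VY i p W \<alpha> \<beta>}"
  then obtain \<beta> where \<alpha>: "\<alpha> \<in> G_carrier Y VY j W" and \<beta>: "\<beta> \<in> G_carrier X VX j (preim (mtop X) i W)"
    and r: "restricts_to X VX Y VY i p W \<alpha> \<beta>" by blast
  note sY = aut_subsheaf_G_carrier[OF Y, of j, unfolded aut_subsheaf_def, rule_format, OF \<alpha>]
    and sX = aut_subsheaf_G_carrier[OF X, of j, unfolded aut_subsheaf_def, rule_format, OF \<beta>]
  show "\<alpha> \<in> sheaf_auts ?SY W" "local_aut ?SY W \<alpha>"
    using sY by blast+
  fix W' assume W': "W' \<subseteq> W"
  let ?\<alpha> = "restrict \<alpha> (opens_in ?SY W')" and ?\<beta> = "restrict \<beta> (opens_in ?SX (preim (mtop X) i W'))"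
  have pre: "preim (mtop X) i W' \<subseteq> preim (mtop X) i W"
    using W' by (auto simp: preim_def)
  have "?\<beta> (preim (mtop X) i V) = \<beta> (preim (mtop X) i V)" if "V \<in> opens_in ?SY W'" for V
  proof (cases "openin (mtop X) (preim (mtop X) i V)")
    case True
    then show ?thesis using that by (auto simp: opens_in_def preim_def)
  next
    case False
    then have "preim (mtop X) i V \<notin> opens_in ?SX Z" for Z by (simp add: opens_in_def)
    then show ?thesis
      using sheaf_auts_extensional(1)[of \<beta> ?SX "preim (mtop X) i W"] sX by (simp add: extensional_def)
  qed
  moreover have "V \<in> opens_in ?SY W" if "V \<in> opens_in ?SY W'" for V
    using that W' by (rule opens_in_trans)
  ultimately have "restricts_to X VX Y VY i p W' ?\<alpha> ?\<beta>"
    using r unfolding restricts_to_def by simp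
  moreover have "?\<alpha> \<in> G_carrier Y VY j W'" "?\<beta> \<in> G_carrier X VX j (preim (mtop X) i W')"
    using sY sX W' pre by blast+
  ultimately show "?\<alpha> \<in> {\<alpha> \<in> G_carrier Y VY j W'.
      \<exists>\<beta>\<in>G_carrier X VX j (preim (mtop X) i W'). restricts_to X VX Y VY i p W' \<alpha> \<beta>}"
    by blast
qed

lemma cocycles_level_mono:
  assumes "k \<le> j" "S \<in> cocycles T (G_sheaf M E j)"
  shows "S \<in> cocycles T (G_sheaf M E k)"
proof -
  have "G_carrier M E j W \<subseteq> G_carrier M E k W" for W
    using order.strict_trans2[OF _ assms(1)] unfolding G_carrier_def by blast
  then show ?thesis
    using assms(2) by (cases S) (simp add: cocycles_def G_sheaf_def subset_iff)
qed

lemma level_map_class: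
  assumes E: "is_model M E" and k: "k \<le> j" and S: "S \<in> cocycles (mtop M) (G_sheaf M E j)"
  shows "S \<in> level_map M E j k (sm_class M E j S)"
proof -
  obtain \<U> g where S': "S = (\<U>, g)" by (cases S)
  have refl: "(S, S) \<in> cohomology_rel (mtop M) (G_sheaf M E l)" if "S \<in> cocycles (mtop M) (G_sheaf M E l)" for l
    using cohomology_rel_refl[OF aut_subsheaf_G_carrier[OF E]] that by (simp add: G_sheaf_def)
  note Sk = cocycles_level_mono[OF k S]
  have "g U V = gs_res (G_sheaf M E k) (preim (mtop M) (\<lambda>y. y) (U \<inter> V)) (U \<inter> V) (g U V)" if "U \<in> \<U>" "V \<in> \<U>" for U V
  proof -
    have "g U V \<in> extensional (opens_in (split_model M E) (U \<inter> V))"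
      using Sk that unfolding S' by (auto simp: cocycles_def G_sheaf_def G_carrier_def sheaf_auts_def)
    then show ?thesis
      by (simp add: G_sheaf_def extensional_restrict)
  qed
  then show ?thesis
    unfolding level_map_def H1_map_def sm_class_def H1_class_def
    using refl[OF S] refl[OF Sk] Sk unfolding S'
    by (intro UN_I[of "(\<U>, g)"]) (auto intro!: exI[of _ "\<lambda>U. U"] ImageI[of "(\<U>, g)"])
qed

lemma H1_mapE:
  assumes "d \<in> H1_map TX FX FY i \<phi> c"
  obtains \<U> g \<V> h \<tau> where "(\<U>, g) \<in> c" "(\<V>, h) \<in> cocycles TX FX" "((\<V>, h), d) \<in> cohomology_rel TX FX"
    "\<And>V. V \<in> \<V> \<Longrightarrow> \<tau> V \<in> \<U> \<and> i ` V \<subseteq> \<tau> V"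
    "\<And>V V'. V \<in> \<V> \<Longrightarrow> V' \<in> \<V> \<Longrightarrow>
      h V V' = gs_res FX (preim TX i (\<tau> V \<inter> \<tau> V')) (V \<inter> V') (\<phi> (\<tau> V \<inter> \<tau> V') (g (\<tau> V) (\<tau> V')))"
proof -
  from assms obtain \<U> g where c: "(\<U>, g) \<in> c" and d: "d \<in> cohomology_rel TX FX `` {(\<V>, h).
     (\<V>, h) \<in> cocycles TX FX \<and>
     (\<exists>\<tau>. (\<forall>V\<in>\<V>. \<tau> V \<in> \<U> \<and> i ` V \<subseteq> \<tau> V) \<and>
        (\<forall>V\<in>\<V>. \<forall>V'\<in>\<V>. h V V' =
           gs_res FX (preim TX i (\<tau> V \<inter> \<tau> V')) (V \<inter> V') (\<phi> (\<tau> V \<inter> \<tau> V') (g (\<tau> V) (\<tau> V')))))}"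
    unfolding H1_map_def by (elim UN_E) (auto split: prod.splits)
  from d obtain \<V> h where "((\<V>, h), d) \<in> cohomology_rel TX FX" "(\<V>, h) \<in> cocycles TX FX"
    and "\<exists>\<tau>. (\<forall>V\<in>\<V>. \<tau> V \<in> \<U> \<and> i ` V \<subseteq> \<tau> V) \<and>
        (\<forall>V\<in>\<V>. \<forall>V'\<in>\<V>. h V V' =
           gs_res FX (preim TX i (\<tau> V \<inter> \<tau> V')) (V \<inter> V') (\<phi> (\<tau> V \<inter> \<tau> V') (g (\<tau> V) (\<tau> V'))))"
    unfolding Image_iff mem_Collect_eq by (elim bexE) (auto split: prod.splits)
  then show ?thesis
    using that[OF c] by metis
qed

theorem corollary1p2p10:
  fixes X :: "'x cmfd" and VX :: "('x, 'd) vbundle"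
    and Y :: "'y cmfd" and VY :: "('y, 'e) vbundle"
    and B :: "'b cmfd" and b0 :: 'b
    and j' :: enat and S :: "('y, 'e) gluing_data"
    and f :: "'y \<Rightarrow> 'b" and fs :: "'b set \<Rightarrow> ('b \<Rightarrow> complex) \<Rightarrow> 'y set \<Rightarrow> ('y, 'e) fsection"
    and F :: "'b \<Rightarrow> ('x, 'd, 'y, 'e) family_fibre"
  assumes "splitting_type_deformation X VX Y VY B b0 j' S f fs F"
    and "represents_split_embedding X VX Y VY (F b0)"
  shows "sm_split Y VY S"
proof -
  let ?i = "fib_incl (F b0)" and ?p = "fib_surj (F b0)" and ?k = "fib_level (F b0)"
  let ?T = "mtop Y" and ?R = "split_model Y VY"
  let ?C = "\<lambda>W. {\<alpha> \<in> G_carrier Y VY ?k W.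
    \<exists>\<beta>\<in>G_carrier X VX ?k (preim (mtop X) ?i W). restricts_to X VX Y VY ?i ?p W \<alpha> \<beta>}"
  let ?one = "\<lambda>U V. \<one>\<^bsub>gs_grp (rel_G_sheaf X VX Y VY ?i ?p ?k) (topspace ?T)\<^esub>"
  have fam: "is_model X VX" "supermanifold Y VY j' S"
    and emb: "embedding_class X VX Y VY ?i ?p ?k (fib_type (F b0)) j' (fib_sm (F b0)) S (fib_class (F b0))"
    using assms(1) unfolding splitting_type_deformation_def supermanifold_family_def by blast+
  have Y: "is_model Y VY" and S: "S \<in> cocycles ?T (G_sheaf Y VY j')"
    using fam(2) unfolding supermanifold_def by blast+
  have k: "?k \<le> j'" and us: "u_star X VX Y VY ?i ?p ?k (fib_class (F b0)) = level_map Y VY j' ?k (sm_class Y VY j' S)"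
    using emb unfolding embedding_class_def by blast+
  have C: "aut_subsheaf ?R ?C" and G: "aut_subsheaf ?R (G_carrier Y VY ?k)"
    by (rule aut_subsheaf_rel[OF fam(1) Y], rule aut_subsheaf_G_carrier[OF Y])
  have "S \<in> u_star X VX Y VY ?i ?p ?k (fib_class (F b0))"
    unfolding us by (rule level_map_class[OF Y k S])
  then have "S \<in> H1_map ?T (G_sheaf Y VY ?k) (rel_G_sheaf X VX Y VY ?i ?p ?k) (\<lambda>y. y) (\<lambda>W \<alpha>. \<alpha>)
      (fib_class (F b0))"
    by (simp only: u_star_def)
  then obtain \<U> g \<V> h \<tau> where
    Ug': "(\<U>, g) \<in> fib_class (F b0)"
    and Vh: "(\<V>, h) \<in> cocycles ?T (G_sheaf Y VY ?k)"
    and VS: "((\<V>, h), S) \<in> cohomology_rel ?T (G_sheaf Y VY ?k)"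
    and \<tau>: "\<And>V. V \<in> \<V> \<Longrightarrow> \<tau> V \<in> \<U> \<and> (\<lambda>y. y) ` V \<subseteq> \<tau> V"
    and h: "\<And>V V'. V \<in> \<V> \<Longrightarrow> V' \<in> \<V> \<Longrightarrow>
      h V V' = gs_res (G_sheaf Y VY ?k) (preim ?T (\<lambda>y. y) (\<tau> V \<inter> \<tau> V')) (V \<inter> V') (g (\<tau> V) (\<tau> V'))"
    by (rule H1_mapE) blast
  have Ug: "(({topspace ?T}, ?one), (\<U>, g)) \<in> cohomology_rel ?T (rel_G_sheaf X VX Y VY ?i ?p ?k)"
    using Ug' assms(2) unfolding represents_split_embedding_def H1_base_def H1_class_def by simp
  obtain \<W> s where S': "S = (\<W>, s)" by (cases S)
  have coh1: "aut_cohomologous ?R ({topspace ?T}, ?one) (\<U>, g)"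
    using aut_cohomologous_cohomology_rel[OF C] Ug by (simp add: rel_G_sheaf_def)
  have "(\<U>, g) \<in> cocycles ?T (aut_gsheaf ?R ?C)"
    using Ug by (auto simp: cohomology_rel_def rel_G_sheaf_def)
  then have gc: "aut_cocycle ?R \<U> g"
    using aut_cocycleI[OF C] by simp
  have hc: "aut_cocycle ?R \<V> h"
    using aut_cocycleI[OF G] Vh by (simp add: G_sheaf_def)
  have sc: "aut_cocycle ?R \<W> s"
    using aut_cocycleI[OF G] cocycles_level_mono[OF k S] by (simp add: G_sheaf_def S')
  have coh2: "aut_cohomologous ?R (\<U>, g) (\<V>, h)"
    by (rule aut_cohomologous_refinement[of _ _ \<tau>]) (use Vh \<tau> h in \<open>auto simp: cocycles_def G_sheaf_def\<close>)
  have coh3: "aut_cohomologous ?R (\<V>, h) (\<W>, s)"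
    using aut_cohomologous_cohomology_rel[OF G] VS by (simp add: G_sheaf_def S')
  have "aut_cohomologous ?R ({topspace ?T}, ?one) (\<W>, s)"
    using aut_cohomologous_trans[OF aut_cohomologous_trans[OF coh1 gc coh2] hc coh3] .
  then show ?thesis
    unfolding S'
  proof (rule sm_split_if_cohomologous_trivial[OF Y sc])
    show "?one A B P t = t" if "openin ?T P" "t \<in> ext_sections Y VY P" for A B :: "'y set" and P t
      using that openin_subset[OF that(1)] by (simp add: rel_G_sheaf_def opens_in_def)
  qed
qed

end
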